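(* Consider the algebraic differential equation $$F(x,y,y')=\sum_{i=1}^n a_i(x)\,y^{p_i}(y')^{q_i}=0,\qquad (1)$$ with polynomial coefficients $a_i\in\mathbb{C}[x]$, and let $x_0\in\mathbb{C}$ be a nonsingular point of (1). Suppose that the polygon of (1) has an inclined edge $I_\lambda$ with inner normal vector $(\lambda,-1)$, where $\lambda=r/s\neq 0$, with $r\in\mathbb{Z}$ and $s\in\mathbb{Z}_{>0}$ coprime. Let $\varphi_0=c(x-x_0)^\lambda\neq 0$ be a non-exceptional solution of the approximate equation corresponding to $I_\lambda$. Then there is a unique Puiseux series $\varphi$ in powers of $x-x_0$ which has first term $\varphi_0$ and satisfies (1), and this series has a nonzero radius of convergence. Moreover, the generator of the power exponents of $\varphi$ is entirely determined by $\lambda$ and is equal to $1/s$.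
   Context: In equation (1), the $a_i$ are nonzero polynomials in $x$ with complex coefficients, and the $(p_i,q_i)$ are pairwise distinct pairs of nonnegative integers; $y'=dy/dx$. Nonsingular point: a point $x_0\in\mathbb{C}$ is a singular point of (1) if it is a zero of at least one of the coefficients $a_i$; otherwise it is nonsingular, i.e. $a_i(x_0)\neq 0$ for all $i$. Polygon: put $Q_i=(M_i,N_i)=(p_i+q_i,\,q_i)$, $i=1,\dots,n$, in the plane. The polygon of (1) (corresponding to any nonsingular point) is the convex-up (upper) part of the boundary of the convex hull of $\{Q_1,\dots,Q_n\}$. The polygon has an inclined edge $I_\lambda$ with inner normal vector $(\lambda,-1)$, $\lambda\neq0$, when the set of points of the convex hull where the linear function $L_\lambda(X,Y)=\lambda X-Y$ attains its minimum is a nondegenerate segment (containing at least two of the $Q_i$); this segment is $I_\lambda$. Approximate equation corresponding to $I_\lambda$: $$\hat F_{x_0,\lambda}(y,y')=\sum_{i:\,Q_i\in I_\lambda}a_i(x_0)\,y^{p_i}(y')^{q_i}=0.$$ Characteristic polynomial corresponding to $I_\lambda$: $$P_{x_0,\lambda}(c)=\sum_{i:\,Q_i\in I_\lambda}a_i(x_0)\,\lambda^{N_i}c^{M_i}.$$ For $c\in\mathbb{C}\setminus\{0\}$, the function $c(x-x_0)^\lambda$ is a solution of the approximate equation exactly when $P_{x_0,\lambda}(c)=0$. Such a solution is called non-exceptional if $c$ is a simple root of $P_{x_0,\lambda}$. Puiseux series: a Puiseux series in powers of $x-x_0$ is a formal Laurent series, with finitely many terms of negative exponent, in $(x-x_0)^{1/k}$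 for some positive integer $k$, with complex coefficients. For every $k$, $(x-x_0)^{1/k}$ is treated as a formal symbol, with compatible choices of roots, and differentiation is termwise. Its first term is its nonzero term of lowest exponent. It has a nonzero radius of convergence if the corresponding Laurent series in $t=(x-x_0)^{1/k}$ converges for all sufficiently small $t\ne0$. That the generator of the power exponents of $\varphi$ is $1/s$ means that $\varphi$ is a series in integer powers of $(x-x_0)^{1/s}$, i.e. all exponents occurring in $\varphi$ are integer multiples of $1/s$. *)

theory Defs
  imports "HOL-Complex_Analysis.Laurent_Convergence" "HOL-Computational_Algebra.Polynomial"
begin

section \<open>Puiseux series\<close>

text \<open>
  A Puiseux series is given by its coefficient function on rational exponents. It does not
  record the expansion point: a term with exponent \<open>e\<close> stands for \<open>(x - x0) ^ e\<close>, and \<open>x0\<close> only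
  enters when the polynomial coefficients of an equation are expanded.
\<close>

typedef puiseux =
  "{f :: rat \<Rightarrow> complex. \<exists>k::nat. k > 0 \<and> (\<exists>N::int. \<forall>e. f e \<noteq> 0 \<longrightarrow>
      (\<exists>n\<ge>N. e = of_int n / of_nat k))}"
  morphisms puiseux_coeff Abs_puiseux
  by (rule exI[of _ "\<lambda>_. 0"]) auto

lemma puiseux_eqI: "(\<And>e. puiseux_coeff f e = puiseux_coeff g e) \<Longrightarrow> f = g"
  by (simp add: puiseux_coeff_inject[symmetric] fun_eq_iff)

definition puiseux_monom :: "complex \<Rightarrow> rat \<Rightarrow> puiseux" where
  "puiseux_monom c e = Abs_puiseux (\<lambda>e'. if e' = e then c else 0)"

lemma puiseux_coeff_monom [simp]:
  "puiseux_coeff (puiseux_monom c e) e' = (if e' = e then c else 0)"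
proof -
  obtain a b :: int where "e = Fract a b" "b > 0" by (cases e) auto
  then have e: "e = of_int a / of_nat (nat b)" "nat b > 0"
    by (auto simp: Fract_of_int_quotient)
  then have "(\<lambda>e'. if e' = e then c else 0) \<in> {f :: rat \<Rightarrow> complex. \<exists>k::nat. k > 0 \<and>
      (\<exists>N::int. \<forall>e. f e \<noteq> 0 \<longrightarrow> (\<exists>n\<ge>N. e = of_int n / of_nat k))}"
    by (intro CollectI exI[of _ "nat b"] conjI exI[of _ a]) auto
  then show ?thesis
    by (simp add: puiseux_monom_def Abs_puiseux_inverse)
qed

abbreviation puiseux_const :: "complex \<Rightarrow> puiseux" where
  "puiseux_const c \<equiv> puiseux_monom c 0"

text \<open>The series obtained from a Laurent series \<open>L\<close> in \<open>t\<close> by putting \<open>t = (x - x0) ^ (1/k)\<close>,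
  for \<open>k > 0\<close>.\<close>

definition puiseux_of_fls :: "nat \<Rightarrow> complex fls \<Rightarrow> puiseux" where
  "puiseux_of_fls k L =
     Abs_puiseux (\<lambda>e. if of_nat k * e \<in> \<int> then fls_nth L \<lfloor>of_nat k * e\<rfloor> else 0)"

lemma puiseux_coeff_of_fls:
  assumes "k > 0"
  shows "puiseux_coeff (puiseux_of_fls k L) e =
           (if of_nat k * e \<in> \<int> then fls_nth L \<lfloor>of_nat k * e\<rfloor> else 0)"
proof -
  have "\<exists>n\<ge>fls_subdegree L. e = of_int n / of_nat k"
    if "(if of_nat k * e \<in> \<int> then fls_nth L \<lfloor>of_nat k * e\<rfloor> else 0) \<noteq> 0" for e :: rat
  proof -
    have "of_nat k * e \<in> \<int>" and nz: "fls_nth L \<lfloor>of_nat k * e\<rfloor> \<noteq> 0"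
      using that by (auto split: if_splits)
    then obtain n where n: "of_nat k * e = of_int n" by (auto elim: Ints_cases)
    have "fls_nth L n \<noteq> 0" using nz n by simp
    then have "n \<ge> fls_subdegree L" by (rule fls_subdegree_leI)
    moreover have "e = of_int n / of_nat k" using n assms by (simp add: field_simps)
    ultimately show ?thesis by blast
  qed
  then have "(\<lambda>e. if of_nat k * e \<in> \<int> then fls_nth L \<lfloor>of_nat k * e\<rfloor> else 0) \<in>
      {f :: rat \<Rightarrow> complex. \<exists>k::nat. k > 0 \<and>
      (\<exists>N::int. \<forall>e. f e \<noteq> 0 \<longrightarrow> (\<exists>n\<ge>N. e = of_int n / of_nat k))}"
    using assms by blast
  then show ?thesis
    by (simp add: puiseux_of_fls_def Abs_puiseux_inverse)
qed

lemma puiseux_coeff_of_fls_frac [simp]: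
  assumes "k > 0"
  shows "puiseux_coeff (puiseux_of_fls k L) (of_int n / of_nat k) = fls_nth L n"
  using assms by (simp add: puiseux_coeff_of_fls)

lemma puiseux_of_fls_eqI:
  assumes "k > 0"
    and "\<And>n. puiseux_coeff f (of_int n / of_nat k) = fls_nth L n"
    and "\<And>e. of_nat k * e \<notin> \<int> \<Longrightarrow> puiseux_coeff f e = 0"
  shows "f = puiseux_of_fls k L"
proof (rule puiseux_eqI)
  fix e
  show "puiseux_coeff f e = puiseux_coeff (puiseux_of_fls k L) e"
  proof (cases "of_nat k * e \<in> \<int>")
    case True
    then obtain n where n: "of_nat k * e = of_int n" by (auto elim: Ints_cases)
    then have "e = of_int n / of_nat k" using assms(1) by (simp add: field_simps)
    then show ?thesis using assms by simp
  next
    case False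
    then show ?thesis using assms by (simp add: puiseux_coeff_of_fls)
  qed
qed

lemma ex_puiseux_of_fls:
  "\<exists>k::nat. k > 0 \<and> (\<forall>d>0. \<exists>L. f = puiseux_of_fls (k * d) L)"
proof -
  obtain k :: nat and N :: int where k: "k > 0"
    and N: "\<And>e. puiseux_coeff f e \<noteq> 0 \<Longrightarrow> \<exists>n\<ge>N. e = of_int n / of_nat k"
    using puiseux_coeff[of f] by auto
  have "\<exists>L. f = puiseux_of_fls (k * d) L" if d: "d > 0" for d
  proof -
    define g where "g n = puiseux_coeff f (of_int n / of_nat (k * d))" for n
    have "g n = 0" if "n < N * int d" for n
    proof (rule ccontr)
      assume "g n \<noteq> 0"
      then obtain m where m: "m \<ge> N" "of_int n / of_nat (k * d) = (of_int m / of_nat k :: rat)"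
        using N unfolding g_def by blast
      from m(2) have "(of_int n :: rat) = of_int (m * int d)"
        using k d by (simp add: field_simps)
      then have "n = m * int d" by (simp only: of_int_eq_iff)
      moreover have "N * int d \<le> m * int d" using m(1) by (intro mult_right_mono) auto
      ultimately show False using \<open>n < N * int d\<close> by simp
    qed
    then have L: "fls_nth (Abs_fls g) n = g n" for n
      by (intro nth_Abs_fls_ex_lower_bound) auto
    have "f = puiseux_of_fls (k * d) (Abs_fls g)"
    proof (rule puiseux_of_fls_eqI)
      show "k * d > 0" using k d by simp
      show "puiseux_coeff f (of_int n / of_nat (k * d)) = fls_nth (Abs_fls g) n" for n
        using L[of n] by (simp add: g_def)
      fix e :: rat assume e: "of_nat (k * d) * e \<notin> \<int>"
      show "puiseux_coeff f e = 0"
      proof (rule ccontr)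
        assume "puiseux_coeff f e \<noteq> 0"
        then obtain m where "e = of_int m / of_nat k" using N by blast
        then have "of_nat (k * d) * e = of_int (int d * m)"
          using k by (simp add: field_simps)
        then show False using e by (metis Ints_of_int)
      qed
    qed
    then show ?thesis by blast
  qed
  with k show ?thesis by blast
qed

lemma common_puiseux_of_fls:
  "\<exists>k>0. \<exists>L M N. f = puiseux_of_fls k L \<and> g = puiseux_of_fls k M \<and> h = puiseux_of_fls k N"
proof -
  obtain a where a: "a > 0" "\<And>d. d > 0 \<Longrightarrow> \<exists>L. f = puiseux_of_fls (a * d) L"
    using ex_puiseux_of_fls[of f] by blast
  obtain b where b: "b > 0" "\<And>d. d > 0 \<Longrightarrow> \<exists>L. g = puiseux_of_fls (b * d) L"
    using ex_puiseux_of_fls[of g] by blast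
  obtain c where c: "c > 0" "\<And>d. d > 0 \<Longrightarrow> \<exists>L. h = puiseux_of_fls (c * d) L"
    using ex_puiseux_of_fls[of h] by blast
  have eq: "b * (a * c) = a * (b * c)" "c * (a * b) = a * (b * c)" by (simp_all add: ac_simps)
  have "\<exists>L. f = puiseux_of_fls (a * (b * c)) L" using a(2)[of "b * c"] b(1) c(1) by simp
  moreover have "\<exists>M. g = puiseux_of_fls (a * (b * c)) M"
    using b(2)[of "a * c"] a(1) c(1) unfolding eq by simp
  moreover have "\<exists>N. h = puiseux_of_fls (a * (b * c)) N"
    using c(2)[of "a * b"] a(1) b(1) unfolding eq by simp
  moreover have "a * (b * c) > 0" using a(1) b(1) c(1) by simp
  ultimately show ?thesis by blast
qed

lemma common_puiseux_of_fls2: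
  obtains k L M where "k > 0" "f = puiseux_of_fls k L" "g = puiseux_of_fls k M"
  using common_puiseux_of_fls[of f g f] by blast

lemma common_puiseux_of_fls3:
  obtains k L M N where "k > 0" "f = puiseux_of_fls k L" "g = puiseux_of_fls k M"
    "h = puiseux_of_fls k N"
  using common_puiseux_of_fls[of f g h] by blast

instantiation puiseux :: comm_ring_1
begin

definition "0 = puiseux_const 0"

definition "1 = puiseux_const 1"

definition "f + g = Abs_puiseux (\<lambda>e. puiseux_coeff f e + puiseux_coeff g e)"

definition "- f = Abs_puiseux (\<lambda>e. - puiseux_coeff f e)"

definition "f - g = Abs_puiseux (\<lambda>e. puiseux_coeff f e - puiseux_coeff g e)"

definition "f * g = Abs_puiseux (\<lambda>e.
   \<Sum>d | puiseux_coeff f d \<noteq> 0 \<and> puiseux_coeff g (e - d) \<noteq> 0.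
     puiseux_coeff f d * puiseux_coeff g (e - d))"

lemma puiseux_of_fls_0: "k > 0 \<Longrightarrow> puiseux_of_fls k 0 = 0"
  by (rule puiseux_eqI) (simp add: zero_puiseux_def puiseux_coeff_of_fls)

lemma puiseux_of_fls_1: "k > 0 \<Longrightarrow> puiseux_of_fls k 1 = 1"
  by (rule sym, rule puiseux_of_fls_eqI) (auto simp: one_puiseux_def)

lemma puiseux_of_fls_add:
  "k > 0 \<Longrightarrow> puiseux_of_fls k (L + M) = puiseux_of_fls k L + puiseux_of_fls k M"
  unfolding plus_puiseux_def
  by (subst puiseux_of_fls_def, rule arg_cong[of _ _ Abs_puiseux])
     (auto simp: fun_eq_iff puiseux_coeff_of_fls)

lemma puiseux_of_fls_uminus:
  "k > 0 \<Longrightarrow> puiseux_of_fls k (- L) = - puiseux_of_fls k L"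
  unfolding uminus_puiseux_def
  by (subst puiseux_of_fls_def, rule arg_cong[of _ _ Abs_puiseux])
     (auto simp: fun_eq_iff puiseux_coeff_of_fls)

lemma puiseux_of_fls_diff:
  "k > 0 \<Longrightarrow> puiseux_of_fls k (L - M) = puiseux_of_fls k L - puiseux_of_fls k M"
  unfolding minus_puiseux_def
  by (subst puiseux_of_fls_def, rule arg_cong[of _ _ Abs_puiseux])
     (auto simp: fun_eq_iff puiseux_coeff_of_fls)

lemma puiseux_coeff_conv_of_fls:
  fixes L M :: "complex fls" and k :: nat and e :: rat
  assumes k: "k > 0"
  defines "f \<equiv> puiseux_of_fls k L" and "g \<equiv> puiseux_of_fls k M"
  defines "D \<equiv> {d. puiseux_coeff f d \<noteq> 0 \<and> puiseux_coeff g (e - d) \<noteq> 0}"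
  shows "finite D"
    and "(\<Sum>d\<in>D. puiseux_coeff f d * puiseux_coeff g (e - d)) =
           (if of_nat k * e \<in> \<int> then fls_nth (L * M) \<lfloor>of_nat k * e\<rfloor> else 0)"
proof -
  have "finite D \<and> (\<Sum>d\<in>D. puiseux_coeff f d * puiseux_coeff g (e - d)) =
           (if of_nat k * e \<in> \<int> then fls_nth (L * M) \<lfloor>of_nat k * e\<rfloor> else 0)"
  proof (cases "of_nat k * e \<in> \<int>")
    case False
    have "D = {}"
    proof (rule equals0I)
      fix d assume "d \<in> D"
      then have "of_nat k * d \<in> \<int>" "of_nat k * (e - d) \<in> \<int>"
        using k by (auto simp: D_def f_def g_def puiseux_coeff_of_fls split: if_splits)
      then have "of_nat k * d + of_nat k * (e - d) \<in> \<int>" by (rule Ints_add)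
      then show False using False by (simp add: algebra_simps)
    qed
    then show ?thesis using False by simp
  next
    case True
    then obtain n where n: "of_nat k * e = of_int n" by (auto elim: Ints_cases)
    then have e: "e = of_int n / of_nat k" using k by (simp add: field_simps)
    define J where "J = {i. fls_nth L i \<noteq> 0 \<and> fls_nth M (n - i) \<noteq> 0}"
    have diff: "e - of_int i / of_nat k = of_int (n - i) / of_nat k" for i
      by (simp add: e diff_divide_distrib)
    have J_sub: "J \<subseteq> {fls_subdegree L..n - fls_subdegree M}"
    proof
      fix i assume "i \<in> J"
      then have "fls_subdegree L \<le> i" "fls_subdegree M \<le> n - i"
        by (auto simp: J_def intro: fls_subdegree_leI)
      then show "i \<in> {fls_subdegree L..n - fls_subdegree M}" by simp
    qed
    have inj: "inj_on (\<lambda>i::int. of_int i / of_nat k :: rat) J"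
      using k by (auto intro!: inj_onI)
    have cL: "puiseux_coeff f (of_int i / of_nat k) = fls_nth L i" for i
      using k by (simp add: f_def)
    have cM: "puiseux_coeff g (e - of_int i / of_nat k) = fls_nth M (n - i)" for i
      unfolding diff g_def by (rule puiseux_coeff_of_fls_frac[OF k])
    have D_eq: "D = (\<lambda>i::int. of_int i / of_nat k) ` J"
    proof (rule set_eqI, rule iffI)
      fix d assume d: "d \<in> D"
      then have "of_nat k * d \<in> \<int>"
        using k by (auto simp: D_def f_def puiseux_coeff_of_fls split: if_splits)
      then obtain i where "of_nat k * d = of_int i" by (auto elim: Ints_cases)
      then have i: "d = of_int i / of_nat k" using k by (simp add: field_simps)
      then have "i \<in> J" using d cL cM by (auto simp: D_def J_def)
      then show "d \<in> (\<lambda>i::int. of_int i / of_nat k) ` J" using i by blast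
    next
      fix d assume "d \<in> (\<lambda>i::int. of_int i / of_nat k :: rat) ` J"
      then obtain i where "i \<in> J" "d = of_int i / of_nat k" by blast
      then show "d \<in> D" using cL cM by (auto simp: D_def J_def)
    qed
    have "finite J" using J_sub by (rule finite_subset) simp
    moreover have "(\<Sum>d\<in>D. puiseux_coeff f d * puiseux_coeff g (e - d)) =
        (\<Sum>i\<in>J. fls_nth L i * fls_nth M (n - i))"
      unfolding D_eq by (subst sum.reindex[OF inj]) (simp add: cL cM)
    moreover have "\<dots> = (\<Sum>i=fls_subdegree L..n - fls_subdegree M. fls_nth L i * fls_nth M (n - i))"
      using J_sub by (intro sum.mono_neutral_left) (auto simp: J_def)
    moreover have "\<dots> = fls_nth (L * M) n" by (rule fls_times_nth(2)[symmetric])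
    ultimately show ?thesis using True n D_eq by simp
  qed
  then show "finite D" "(\<Sum>d\<in>D. puiseux_coeff f d * puiseux_coeff g (e - d)) =
           (if of_nat k * e \<in> \<int> then fls_nth (L * M) \<lfloor>of_nat k * e\<rfloor> else 0)"
    by blast+
qed

lemma puiseux_of_fls_mult:
  "k > 0 \<Longrightarrow> puiseux_of_fls k (L * M) = puiseux_of_fls k L * puiseux_of_fls k M"
  unfolding times_puiseux_def
  by (subst puiseux_of_fls_def, rule arg_cong[of _ _ Abs_puiseux])
     (simp add: fun_eq_iff puiseux_coeff_conv_of_fls)

instance
proof
  fix f g h :: puiseux
  note hom = puiseux_of_fls_add[symmetric] puiseux_of_fls_diff[symmetric]
    puiseux_of_fls_mult[symmetric] puiseux_of_fls_uminus[symmetric]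
    puiseux_of_fls_0[symmetric] puiseux_of_fls_1[symmetric]
  obtain k L M N where k: "k > 0" and rep: "f = puiseux_of_fls k L" "g = puiseux_of_fls k M"
    "h = puiseux_of_fls k N" by (rule common_puiseux_of_fls3)
  show "f + g + h = f + (g + h)" unfolding rep by (simp add: hom k add.assoc)
  show "f + g = g + f" unfolding rep by (simp add: hom k add.commute)
  show "0 + f = f" unfolding rep by (simp add: puiseux_of_fls_0[OF k, symmetric] hom(1) k)
  show "- f + f = 0" unfolding rep by (simp add: puiseux_of_fls_0[OF k, symmetric] hom(1,4) k)
  show "f - g = f + - g" unfolding rep by (simp add: hom(1,2,4) k)
  show "f * g * h = f * (g * h)" unfolding rep by (simp add: hom(3) k mult.assoc)
  show "f * g = g * f" unfolding rep by (simp add: hom(3) k mult.commute)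
  show "1 * f = f" unfolding rep by (simp add: puiseux_of_fls_1[OF k, symmetric] hom(3) k)
  show "(f + g) * h = f * h + g * h" unfolding rep by (simp add: hom(1,3) k distrib_right)
  have "puiseux_coeff 0 0 \<noteq> puiseux_coeff 1 0"
    unfolding zero_puiseux_def one_puiseux_def by simp
  then show "(0::puiseux) \<noteq> 1" by auto
qed

end

lemma puiseux_coeff_0 [simp]: "puiseux_coeff 0 e = 0"
  by (simp add: zero_puiseux_def)

lemma puiseux_coeff_1: "puiseux_coeff 1 e = (if e = 0 then 1 else 0)"
  by (simp add: one_puiseux_def)

lemma puiseux_coeff_add [simp]:
  "puiseux_coeff (f + g) e = puiseux_coeff f e + puiseux_coeff g e"
proof -
  obtain k L M where "k > 0" "f = puiseux_of_fls k L" "g = puiseux_of_fls k M"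
    by (rule common_puiseux_of_fls2)
  then show ?thesis
    by (simp add: puiseux_of_fls_add[symmetric] puiseux_coeff_of_fls)
qed

lemma puiseux_coeff_uminus [simp]: "puiseux_coeff (- f) e = - puiseux_coeff f e"
proof -
  obtain k L M where "k > 0" "f = puiseux_of_fls k L" "f = puiseux_of_fls k M"
    by (rule common_puiseux_of_fls2)
  then show ?thesis
    by (metis add_eq_0_iff puiseux_coeff_0 puiseux_coeff_add right_minus)
qed

lemma puiseux_coeff_diff [simp]:
  "puiseux_coeff (f - g) e = puiseux_coeff f e - puiseux_coeff g e"
  using puiseux_coeff_add[of f "- g" e] by simp

lemma puiseux_coeff_mult:
  "puiseux_coeff (f * g) e = (\<Sum>d | puiseux_coeff f d \<noteq> 0 \<and> puiseux_coeff g (e - d) \<noteq> 0.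
     puiseux_coeff f d * puiseux_coeff g (e - d))"
proof -
  obtain k L M where "k > 0" "f = puiseux_of_fls k L" "g = puiseux_of_fls k M"
    by (rule common_puiseux_of_fls2)
  then show ?thesis
    by (simp only: puiseux_of_fls_mult[symmetric] puiseux_coeff_conv_of_fls(2)
        puiseux_coeff_of_fls[of k "L * M"])
qed

definition puiseux_deriv :: "puiseux \<Rightarrow> puiseux" where
  "puiseux_deriv f = Abs_puiseux (\<lambda>e. of_rat (e + 1) * puiseux_coeff f (e + 1))"

lemma puiseux_coeff_deriv [simp]:
  "puiseux_coeff (puiseux_deriv f) e = of_rat (e + 1) * puiseux_coeff f (e + 1)"
proof -
  obtain k :: nat and N :: int where k: "k > 0"
    and N: "\<And>e. puiseux_coeff f e \<noteq> 0 \<Longrightarrow> \<exists>n\<ge>N. e = of_int n / of_nat k"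
    using puiseux_coeff[of f] by auto
  have "\<exists>n\<ge>N - int k. e = of_int n / of_nat k"
    if nz: "of_rat (e + 1) * puiseux_coeff f (e + 1) \<noteq> 0" for e
  proof -
    obtain n where "n \<ge> N" "e + 1 = of_int n / of_nat k" using nz N[of "e + 1"] by auto
    then show ?thesis using k by (intro exI[of _ "n - int k"]) (auto simp: field_simps)
  qed
  then have "(\<lambda>e. of_rat (e + 1) * puiseux_coeff f (e + 1)) \<in>
      {f :: rat \<Rightarrow> complex. \<exists>k::nat. k > 0 \<and>
      (\<exists>N::int. \<forall>e. f e \<noteq> 0 \<longrightarrow> (\<exists>n\<ge>N. e = of_int n / of_nat k))}"
    using k by blast
  then show ?thesis
    by (simp add: puiseux_deriv_def Abs_puiseux_inverse)
qed

definition has_first_term :: "puiseux \<Rightarrow> complex \<Rightarrow> rat \<Rightarrow> bool" where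
  "has_first_term f c e \<longleftrightarrow>
     c \<noteq> 0 \<and> puiseux_coeff f e = c \<and> (\<forall>e'<e. puiseux_coeff f e' = 0)"

text \<open>The choice of \<open>k\<close> is immaterial: passing to a multiple of \<open>k\<close> substitutes a power of \<open>t\<close>
  into the Laurent series, which preserves positivity of the radius of convergence.\<close>

definition puiseux_convergent :: "puiseux \<Rightarrow> bool" where
  "puiseux_convergent f \<longleftrightarrow>
     (\<exists>k>0. \<exists>L. f = puiseux_of_fls k L \<and> fls_conv_radius L > 0)"

definition exponents_generated_by :: "rat \<Rightarrow> puiseux \<Rightarrow> bool" where
  "exponents_generated_by g f \<longleftrightarrow>
     (\<forall>e. puiseux_coeff f e \<noteq> 0 \<longrightarrow> (\<exists>m::int. e = of_int m * g))"


section \<open>The differential equation\<close>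

text \<open>The equation is given by \<open>n\<close>, \<open>a\<close>, \<open>p\<close>, \<open>q\<close>, with terms indexed by \<open>{1..n}\<close>.\<close>

definition equation_data ::
    "nat \<Rightarrow> (nat \<Rightarrow> complex poly) \<Rightarrow> (nat \<Rightarrow> nat) \<Rightarrow> (nat \<Rightarrow> nat) \<Rightarrow> bool" where
  "equation_data n a p q \<longleftrightarrow>
     (\<forall>i\<in>{1..n}. a i \<noteq> 0) \<and> inj_on (\<lambda>i. (p i, q i)) {1..n}"

definition nonsingular_point :: "nat \<Rightarrow> (nat \<Rightarrow> complex poly) \<Rightarrow> complex \<Rightarrow> bool" where
  "nonsingular_point n a x0 \<longleftrightarrow> (\<forall>i\<in>{1..n}. poly (a i) x0 \<noteq> 0)"

text \<open>The value of a polynomial at \<open>x = x0 + (x - x0)\<close>, as a series in powers of \<open>x - x0\<close>.\<close>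

definition expand_at :: "complex \<Rightarrow> complex poly \<Rightarrow> puiseux" where
  "expand_at x0 a = poly (map_poly puiseux_const a) (puiseux_const x0 + puiseux_monom 1 1)"

definition ode_lhs ::
    "nat \<Rightarrow> (nat \<Rightarrow> complex poly) \<Rightarrow> (nat \<Rightarrow> nat) \<Rightarrow> (nat \<Rightarrow> nat) \<Rightarrow> complex \<Rightarrow> puiseux \<Rightarrow> puiseux"
  where
  "ode_lhs n a p q x0 y = (\<Sum>i=1..n. expand_at x0 (a i) * y ^ p i * puiseux_deriv y ^ q i)"

definition term_point :: "(nat \<Rightarrow> nat) \<Rightarrow> (nat \<Rightarrow> nat) \<Rightarrow> nat \<Rightarrow> real \<times> real" where
  "term_point p q i = (real (p i + q i), real (q i))"

text \<open>The part of the convex hull of the points where \<open>lam * X - Y\<close> is minimal.\<close>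

definition newton_face :: "nat \<Rightarrow> (nat \<Rightarrow> nat) \<Rightarrow> (nat \<Rightarrow> nat) \<Rightarrow> real \<Rightarrow> (real \<times> real) set" where
  "newton_face n p q lam =
     (let H = convex hull (term_point p q ` {1..n})
      in {P \<in> H. \<forall>P'\<in>H. lam * fst P - snd P \<le> lam * fst P' - snd P'})"

definition has_inclined_edge :: "nat \<Rightarrow> (nat \<Rightarrow> nat) \<Rightarrow> (nat \<Rightarrow> nat) \<Rightarrow> real \<Rightarrow> bool" where
  "has_inclined_edge n p q lam \<longleftrightarrow>
     lam \<noteq> 0 \<and> (\<exists>A B. A \<noteq> B \<and> newton_face n p q lam = closed_segment A B)"

definition edge_terms :: "nat \<Rightarrow> (nat \<Rightarrow> nat) \<Rightarrow> (nat \<Rightarrow> nat) \<Rightarrow> real \<Rightarrow> nat set" where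
  "edge_terms n p q lam = {i \<in> {1..n}. term_point p q i \<in> newton_face n p q lam}"

definition approx_lhs ::
    "nat \<Rightarrow> (nat \<Rightarrow> complex poly) \<Rightarrow> (nat \<Rightarrow> nat) \<Rightarrow> (nat \<Rightarrow> nat) \<Rightarrow> complex \<Rightarrow> rat \<Rightarrow> puiseux \<Rightarrow> puiseux"
  where
  "approx_lhs n a p q x0 lam y =
     (\<Sum>i\<in>edge_terms n p q (of_rat lam).
        puiseux_const (poly (a i) x0) * y ^ p i * puiseux_deriv y ^ q i)"

definition char_poly ::
    "nat \<Rightarrow> (nat \<Rightarrow> complex poly) \<Rightarrow> (nat \<Rightarrow> nat) \<Rightarrow> (nat \<Rightarrow> nat) \<Rightarrow> complex \<Rightarrow> rat \<Rightarrow> complex poly"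
  where
  "char_poly n a p q x0 lam =
     (\<Sum>i\<in>edge_terms n p q (of_rat lam).
        monom (poly (a i) x0 * of_rat lam ^ q i) (p i + q i))"

text \<open>Nonvanishing of the characteristic polynomial is required separately because \<open>order\<close> is
  only meaningful for nonzero polynomials.\<close>

definition non_exceptional_solution ::
    "nat \<Rightarrow> (nat \<Rightarrow> complex poly) \<Rightarrow> (nat \<Rightarrow> nat) \<Rightarrow> (nat \<Rightarrow> nat) \<Rightarrow> complex \<Rightarrow> rat \<Rightarrow> complex \<Rightarrow> bool"
  where
  "non_exceptional_solution n a p q x0 lam c \<longleftrightarrow>
     c \<noteq> 0 \<and>
     approx_lhs n a p q x0 lam (puiseux_monom c lam) = 0 \<and>
     char_poly n a p q x0 lam \<noteq> 0 \<and> order c (char_poly n a p q x0 lam) = 1"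

end

theory Submission
  imports Defs "HOL-Computational_Algebra.Polynomial_FPS"
begin

text \<open>
  Put \<open>t = (x - x0) ^ (1/K)\<close> with \<open>K\<close> a multiple of \<open>s\<close>, and \<open>y = t ^ (K \<lambda>) * u\<close> with \<open>u = c + v\<close>,
  \<open>v(0) = 0\<close>. After division by a power of \<open>t\<close> the equation becomes polynomial in \<open>t\<close>, \<open>v\<close> and
  \<open>w = \<lambda> v + (t d/dt v) / K\<close>, and at \<open>t = 0\<close> only the terms on the edge survive. Since \<open>N - \<lambda> M\<close> is
  constant on the edge and \<open>P(c) = 0\<close>, the linear part at \<open>t = 0\<close> is \<open>P'(c) (v + (t d/dt v) / K)\<close>.
  It multiplies the coefficient of \<open>t ^ j\<close> by \<open>P'(c) (1 + j/K) \<noteq> 0\<close>, so there are no resonances.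
  In the unknown \<open>z = v + (t d/dt v) / K\<close> the equation is a fixed point equation whose right-hand
  side is contracting for the \<open>t\<close>-adic metric, which gives existence and uniqueness; as \<open>v\<close> and
  \<open>w\<close> arise from \<open>z\<close> by bounded coefficient multipliers, it also preserves a small ball for the
  norm \<open>\<Sum>j. |z_j| \<rho> ^ j\<close>, which gives convergence. The exponents are read off the case \<open>K = s\<close>.
\<close>

unbundle no vec_syntax

section \<open>Fixed points in formal power series\<close>

lemma fps_X_power_dvd_iff:
  fixes f :: "'a::field fps"
  shows "fps_X ^ k dvd f \<longleftrightarrow> (\<forall>i<k. f $ i = 0)"
proof
  assume "fps_X ^ k dvd f"
  then obtain g where "f = fps_X ^ k * g" by (rule dvdE)
  then show "\<forall>i<k. f $ i = 0" by (simp add: fps_X_power_mult_nth)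
next
  assume "\<forall>i<k. f $ i = 0"
  then have "fps_cutoff k f = 0" by (simp add: fps_eq_iff)
  then have "f = fps_X ^ k * fps_shift k f"
    using fps_shift_times_fps_X_power'[of k f] fps_shift_cutoff'[of k f] by simp
  then show "fps_X ^ k dvd f" by (rule dvdI)
qed

lemma fps_X_dvd_iff:
  fixes f :: "'a::field fps"
  shows "fps_X dvd f \<longleftrightarrow> f $ 0 = 0"
  using fps_X_power_dvd_iff[of 1 f] by simp

definition fps_multiplier :: "(nat \<Rightarrow> 'a) \<Rightarrow> 'a::comm_ring_1 fps \<Rightarrow> 'a fps" where
  "fps_multiplier f z = Abs_fps (\<lambda>n. f n * z $ n)"

lemma fps_multiplier_nth [simp]: "fps_multiplier f z $ n = f n * z $ n"
  by (simp add: fps_multiplier_def)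

lemma fps_multiplier_diff:
  "fps_multiplier f (y - z) = fps_multiplier f y - fps_multiplier f z"
  by (simp add: fps_eq_iff algebra_simps)

lemma fps_X_power_dvd_multiplier:
  fixes z :: "'a::field fps"
  assumes "fps_X ^ k dvd z"
  shows "fps_X ^ k dvd fps_multiplier f z"
  using assms by (simp add: fps_X_power_dvd_iff)

text \<open>Weighted l1 norm of a truncation: finite for every formal series, so estimates can
  precede any knowledge of convergence, and bounds uniform in \<open>N\<close> then yield
  convergence.\<close>

definition trunc_norm :: "nat \<Rightarrow> real \<Rightarrow> complex fps \<Rightarrow> real" where
  "trunc_norm N \<rho> f = (\<Sum>j\<le>N. norm (f $ j) * \<rho> ^ j)"

lemma trunc_norm_nonneg: "\<rho> \<ge> 0 \<Longrightarrow> trunc_norm N \<rho> f \<ge> 0"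
  by (simp add: trunc_norm_def sum_nonneg)

lemma trunc_norm_1 [simp]: "trunc_norm N \<rho> 1 = 1"
  by (simp add: trunc_norm_def if_distrib if_distribR sum.If_cases cong: if_cong)

lemma trunc_norm_add:
  assumes "\<rho> \<ge> 0"
  shows "trunc_norm N \<rho> (f + g) \<le> trunc_norm N \<rho> f + trunc_norm N \<rho> g"
  unfolding trunc_norm_def sum.distrib[symmetric]
  by (intro sum_mono) (metis assms distrib_right fps_add_nth mult_right_mono norm_triangle_ineq zero_le_power)

lemma trunc_norm_sum:
  assumes "\<rho> \<ge> 0"
  shows "trunc_norm N \<rho> (\<Sum>i\<in>I. f i) \<le> (\<Sum>i\<in>I. trunc_norm N \<rho> (f i))"
proof (induction I rule: infinite_finite_induct)
  case (insert i I)
  then show ?case using trunc_norm_add[OF assms, of N "f i" "sum f I"] by simp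
qed (simp_all add: trunc_norm_def)

text \<open>Up to degree \<open>N\<close> the product only involves index pairs in the triangle
  \<open>i + k \<le> N\<close>, which lies in the square over which the product of the norms is
  summed.\<close>

lemma trunc_norm_mult:
  assumes "\<rho> \<ge> 0"
  shows "trunc_norm N \<rho> (f * g) \<le> trunc_norm N \<rho> f * trunc_norm N \<rho> g"
proof -
  define F where "F i = norm (f $ i) * \<rho> ^ i" for i
  define G where "G i = norm (g $ i) * \<rho> ^ i" for i
  have nn: "F i \<ge> 0" "G i \<ge> 0" for i using assms by (simp_all add: F_def G_def)
  have "norm ((f * g) $ j) * \<rho> ^ j \<le> (\<Sum>i\<le>j. F i * G (j - i))" for j
  proof -
    have "norm ((f * g) $ j) \<le> (\<Sum>i\<le>j. norm (f $ i) * norm (g $ (j - i)))"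
      by (auto simp: fps_mult_nth atLeast0AtMost norm_mult intro: sum_norm_le)
    then have "norm ((f * g) $ j) * \<rho> ^ j \<le>
        (\<Sum>i\<le>j. norm (f $ i) * norm (g $ (j - i))) * \<rho> ^ j"
      using assms by (intro mult_right_mono) auto
    also have "\<dots> = (\<Sum>i\<le>j. F i * G (j - i))"
      unfolding sum_distrib_right F_def G_def
    proof (rule sum.cong)
      fix i assume "i \<in> {..j}"
      then have "\<rho> ^ j = \<rho> ^ i * \<rho> ^ (j - i)" by (simp flip: power_add)
      then show "norm (f $ i) * norm (g $ (j - i)) * \<rho> ^ j =
          norm (f $ i) * \<rho> ^ i * (norm (g $ (j - i)) * \<rho> ^ (j - i))" by simp
    qed simp
    finally show ?thesis .
  qed
  then have "trunc_norm N \<rho> (f * g) \<le> (\<Sum>j\<le>N. \<Sum>i\<le>j. F i * G (j - i))"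
    unfolding trunc_norm_def by (intro sum_mono)
  also have "\<dots> = (\<Sum>(i, k)\<in>{(i, k). i + k \<le> N}. F i * G k)"
    by (rule sum.triangle_reindex_eq[symmetric])
  also have "\<dots> \<le> (\<Sum>(i, k)\<in>{..N} \<times> {..N}. F i * G k)"
    using nn by (intro sum_mono2) auto
  also have "\<dots> = trunc_norm N \<rho> f * trunc_norm N \<rho> g"
    by (simp add: trunc_norm_def F_def G_def sum_product sum.cartesian_product)
  finally show ?thesis .
qed

lemma trunc_norm_power:
  assumes "\<rho> \<ge> 0"
  shows "trunc_norm N \<rho> (f ^ m) \<le> trunc_norm N \<rho> f ^ m"
proof (induction m)
  case (Suc m)
  have "trunc_norm N \<rho> (f ^ Suc m) \<le> trunc_norm N \<rho> f * trunc_norm N \<rho> (f ^ m)"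
    using trunc_norm_mult[OF assms] by simp
  also have "\<dots> \<le> trunc_norm N \<rho> f * trunc_norm N \<rho> f ^ m"
    using Suc trunc_norm_nonneg[OF assms] by (intro mult_left_mono) auto
  finally show ?case by simp
qed simp

lemma trunc_norm_multiplier:
  assumes "\<rho> \<ge> 0" and "\<And>n. norm (f n) \<le> C"
  shows "trunc_norm N \<rho> (fps_multiplier f z) \<le> C * trunc_norm N \<rho> z"
proof -
  have "norm (fps_multiplier f z $ j) * \<rho> ^ j \<le> C * (norm (z $ j) * \<rho> ^ j)" for j
  proof -
    have "norm (f j) * (norm (z $ j) * \<rho> ^ j) \<le> C * (norm (z $ j) * \<rho> ^ j)"
      using assms by (intro mult_right_mono) auto
    then show ?thesis by (simp add: norm_mult mult.assoc)
  qed
  then show ?thesis unfolding trunc_norm_def sum_distrib_left by (intro sum_mono)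
qed

lemma trunc_norm_le_suminf:
  assumes "summable (\<lambda>j. norm (f $ j))" and "0 \<le> \<rho>" "\<rho> \<le> 1"
  shows "trunc_norm N \<rho> f \<le> (\<Sum>j. norm (f $ j))"
proof -
  have "trunc_norm N \<rho> f \<le> (\<Sum>j\<le>N. norm (f $ j))"
    unfolding trunc_norm_def using assms by (intro sum_mono) (simp add: mult_left_le power_le_one)
  also have "\<dots> \<le> (\<Sum>j. norm (f $ j))"
    using assms by (intro sum_le_suminf) auto
  finally show ?thesis .
qed

text \<open>Without a constant coefficient every term carries at least one factor
  \<open>\<rho>\<close>, so the norm becomes small with \<open>\<rho>\<close>.\<close>

lemma trunc_norm_le_suminf_0:
  assumes "summable (\<lambda>j. norm (f $ j))" and "0 \<le> \<rho>" "\<rho> \<le> 1" and "f $ 0 = 0"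
  shows "trunc_norm N \<rho> f \<le> \<rho> * (\<Sum>j. norm (f $ j))"
proof -
  have "norm (f $ j) * \<rho> ^ j \<le> \<rho> * norm (f $ j)" for j
  proof (cases j)
    case (Suc i)
    have "\<rho> ^ j \<le> \<rho>" using assms(2,3) power_le_one[of \<rho> i] by (simp add: Suc mult_left_le)
    then show ?thesis by (metis mult.commute mult_left_mono norm_ge_zero)
  qed (simp add: assms(4))
  then have "trunc_norm N \<rho> f \<le> \<rho> * (\<Sum>j\<le>N. norm (f $ j))"
    unfolding trunc_norm_def sum_distrib_left by (intro sum_mono)
  also have "\<dots> \<le> \<rho> * (\<Sum>j. norm (f $ j))"
    using assms by (intro mult_left_mono sum_le_suminf) auto
  finally show ?thesis .
qed

lemma fps_conv_radius_pos_if_trunc_norm_bounded: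
  assumes "\<rho> > 0" and "\<And>N. trunc_norm N \<rho> f \<le> B"
  shows "fps_conv_radius f > 0"
proof -
  have "summable (\<lambda>j. norm (f $ j) * \<rho> ^ j)"
  proof (rule bounded_imp_summable)
    show "(\<Sum>j\<le>N. norm (f $ j) * \<rho> ^ j) \<le> B" for N using assms(2)[of N] by (simp add: trunc_norm_def)
  qed (use assms(1) in auto)
  then have "summable (\<lambda>j. norm (f $ j * of_real \<rho> ^ j))"
    using assms(1) by (simp add: norm_mult norm_power)
  then have "fps_conv_radius f \<ge> norm (complex_of_real \<rho>)"
    unfolding fps_conv_radius_def by (intro conv_radius_geI) (rule summable_norm_cancel)
  then show ?thesis using assms(1)
    by (metis abs_of_pos ereal_less(2) less_le_trans norm_of_real)
qed

text \<open>\<open>X_congruent k m x x'\<close> expresses that \<open>x\<close> and \<open>x'\<close> are divisible by \<open>X ^ m\<close> and congruent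
  modulo \<open>X ^ (k + m - 1)\<close>; the extra factor \<open>X\<close> avoids the subtraction.\<close>

definition X_congruent :: "nat \<Rightarrow> nat \<Rightarrow> 'a::field fps \<Rightarrow> 'a fps \<Rightarrow> bool" where
  "X_congruent k m x x' \<longleftrightarrow>
     fps_X ^ m dvd x \<and> fps_X ^ m dvd x' \<and> fps_X ^ (k + m) dvd fps_X * (x - x')"

text \<open>Telescoping \<open>x * y - x' * y' = (x - x') * y + x' * (y - y')\<close>: each summand
  adds the order of the remaining factor, so products of series vanishing at 0 gain precision with
  their degree.\<close>

lemma X_congruent_mult:
  assumes "X_congruent k m x x'" "X_congruent k l y y'"
  shows "X_congruent k (m + l) (x * y) (x' * y')"
proof -
  have eq: "fps_X * (x * y - x' * y') = fps_X * (x - x') * y + x' * (fps_X * (y - y'))"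
    by (simp add: algebra_simps)
  have "fps_X ^ (k + (m + l)) dvd fps_X * (x - x') * y"
    using assms mult_dvd_mono[of "fps_X ^ (k + m)" "fps_X * (x - x')" "fps_X ^ l" y]
    by (simp add: X_congruent_def power_add mult.assoc)
  moreover have "fps_X ^ (k + (m + l)) dvd x' * (fps_X * (y - y'))"
    using assms mult_dvd_mono[of "fps_X ^ m" x' "fps_X ^ (k + l)" "fps_X * (y - y')"]
    by (simp add: X_congruent_def power_add mult_ac)
  ultimately have "fps_X ^ (k + (m + l)) dvd fps_X * (x * y - x' * y')"
    unfolding eq by (rule dvd_add)
  with assms show ?thesis
    by (auto simp: X_congruent_def power_add intro: mult_dvd_mono)
qed

lemma X_congruent_power:
  assumes "X_congruent k 1 x x'"
  shows "X_congruent k m (x ^ m) (x' ^ m)"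
proof (induction m)
  case (Suc m)
  then show ?case using X_congruent_mult[OF assms, of m] by simp
qed (simp add: X_congruent_def)

text \<open>Two sources of contraction are built in: \<open>h_0\<close> gives the constant and
  linear terms a factor X, and terms of degree at least 2 contract near 0 by themselves. The
  multipliers \<open>f\<close> and \<open>g\<close> are bounded, so no derivative is lost.\<close>

locale fps_fixed_point =
  fixes I :: "'i set" and h :: "'i \<Rightarrow> complex fps" and \<alpha> \<beta> :: "'i \<Rightarrow> nat"
    and f g :: "nat \<Rightarrow> complex" and C :: real
  assumes finite_I: "finite I"
    and summable_h: "i \<in> I \<Longrightarrow> summable (\<lambda>n. norm (h i $ n))"
    and h_0: "i \<in> I \<Longrightarrow> \<alpha> i + \<beta> i < 2 \<Longrightarrow> h i $ 0 = 0"
    and C: "C > 0" "norm (f n) \<le> C" "norm (g n) \<le> C"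
begin

section \<open>The contraction, its fixed point and its invariant ball\<close>

definition T :: "complex fps \<Rightarrow> complex fps" where
  "T z = (\<Sum>i\<in>I. h i * (fps_multiplier f z ^ \<alpha> i * fps_multiplier g z ^ \<beta> i))"

text \<open>Constant monomials cancel in the difference; linear ones gain the factor X of
  \<open>h i\<close>; from degree 2 on, \<open>X_congruent_mult\<close> supplies the extra
  power.\<close>

lemma T_contracting:
  assumes "z $ 0 = 0" "z' $ 0 = 0" and k: "fps_X ^ k dvd z - z'"
  shows "fps_X ^ Suc k dvd T z - T z'"
proof -
  have cong: "X_congruent k 1 (fps_multiplier e z) (fps_multiplier e z')" for e
    using assms fps_X_power_dvd_multiplier[OF k, of e]
    by (simp add: X_congruent_def fps_X_dvd_iff fps_multiplier_diff mult_dvd_mono)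
  have "fps_X ^ Suc k dvd h i * (fps_multiplier f z ^ \<alpha> i * fps_multiplier g z ^ \<beta> i)
      - h i * (fps_multiplier f z' ^ \<alpha> i * fps_multiplier g z' ^ \<beta> i)" if i: "i \<in> I" for i
  proof -
    define d where "d = fps_multiplier f z ^ \<alpha> i * fps_multiplier g z ^ \<beta> i
      - fps_multiplier f z' ^ \<alpha> i * fps_multiplier g z' ^ \<beta> i"
    have d: "fps_X ^ (k + (\<alpha> i + \<beta> i)) dvd fps_X * d"
      using X_congruent_mult[OF X_congruent_power[OF cong[of f], of "\<alpha> i"]
          X_congruent_power[OF cong[of g], of "\<beta> i"]]
      by (simp add: X_congruent_def d_def)
    consider "\<alpha> i + \<beta> i = 0" | "\<alpha> i + \<beta> i = 1" | "\<alpha> i + \<beta> i \<ge> 2" by linarith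
    then have "fps_X ^ Suc k dvd h i * d"
    proof cases
      case 1
      then show ?thesis by (simp add: d_def)
    next
      case 2
      then have "fps_X ^ k dvd d" using d by simp
      moreover have "fps_X dvd h i" using h_0[OF i] 2 by (simp add: fps_X_dvd_iff)
      ultimately show ?thesis by (simp add: mult_dvd_mono)
    next
      case 3
      then have "fps_X ^ Suc (Suc k) dvd fps_X * d"
        using d by (rule_tac power_le_dvd) auto
      then show ?thesis by (simp add: dvd_mult)
    qed
    then show ?thesis by (simp add: d_def algebra_simps)
  qed
  then show ?thesis unfolding T_def sum_subtractf[symmetric] by (rule dvd_sum)
qed

lemma T_nth_0: "z $ 0 = 0 \<Longrightarrow> T z $ 0 = 0"
  unfolding T_def fps_sum_nth
proof (rule sum.neutral, rule ballI)
  fix i assume "z $ 0 = 0" "i \<in> I"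
  then show "(h i * (fps_multiplier f z ^ \<alpha> i * fps_multiplier g z ^ \<beta> i)) $ 0 = 0"
    using h_0[of i] by (cases "\<alpha> i"; cases "\<beta> i") auto
qed

lemma fixed_point_unique:
  assumes "z $ 0 = 0" "T z = z" "z' $ 0 = 0" "T z' = z'"
  shows "z = z'"
proof -
  have "fps_X ^ k dvd z - z'" for k
  proof (induction k)
    case (Suc k)
    then show ?case using T_contracting[of z z' k] assms by simp
  qed simp
  then have "(z - z') $ n = 0" for n using fps_X_power_dvd_iff[of "Suc n" "z - z'"] by blast
  then show ?thesis by (simp add: fps_eq_iff)
qed

text \<open>The radius \<open>\<delta>\<close> is fixed first, so that terms of degree at least 2
  contribute at most \<open>\<delta> / 2\<close>; then \<open>\<rho>\<close> is taken small relative
  to \<open>\<delta>\<close>, so that the remaining terms do the same. Neither depends on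
  \<open>N\<close>.\<close>

lemma T_norm_bound:
  "\<exists>\<rho>>0. \<exists>\<delta>\<ge>0. \<forall>N z. trunc_norm N \<rho> z \<le> \<delta> \<longrightarrow> trunc_norm N \<rho> (T z) \<le> \<delta>"
proof -
  \<comment> \<open>\<open>H\<close> bounds the norm of every \<open>h i\<close> for all radii up to
    1; the summand 1 makes it positive, as the divisions below require.\<close>
  define H where "H = 1 + (\<Sum>i\<in>I. \<Sum>n. norm (h i $ n))"
  have nn: "(\<Sum>n. norm (h i $ n)) \<ge> 0" if "i \<in> I" for i
    using summable_h[OF that] by (intro suminf_nonneg) auto
  have H: "(\<Sum>n. norm (h i $ n)) \<le> H" if "i \<in> I" for i
  proof -
    have "(\<Sum>n. norm (h i $ n)) \<le> (\<Sum>i\<in>I. \<Sum>n. norm (h i $ n))"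
      using that finite_I nn by (intro member_le_sum) auto
    then show ?thesis by (simp add: H_def)
  qed
  have H0: "H > 0" unfolding H_def by (intro add_pos_nonneg sum_nonneg nn) auto
  define K where "K = real (card I) + 1"
  have K: "K > 0" by (simp add: K_def)
  \<comment> \<open>The first bound gives \<open>C * \<delta> \<le> 1\<close>, so powers of exponent
    at least 2 are dominated by the square; the second makes these terms together at most
    \<open>\<delta> / 2\<close>.\<close>
  define \<delta> where "\<delta> = min (1 / C) (1 / (2 * K * H * C\<^sup>2))"
  define \<rho> where "\<rho> = min 1 (\<delta> / (2 * K * H))"
  have \<delta>: "\<delta> > 0" "C * \<delta> \<le> 1" "K * H * (C * \<delta>)\<^sup>2 \<le> \<delta> / 2"
  proof -
    show "\<delta> > 0" using C(1) K H0 by (simp add: \<delta>_def)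
    have "\<delta> \<le> 1 / C" by (simp add: \<delta>_def)
    then show "C * \<delta> \<le> 1" using C(1) by (simp add: field_simps)
    have "\<delta> \<le> 1 / (2 * K * H * C\<^sup>2)" by (simp add: \<delta>_def)
    then have "\<delta> * (K * H * C\<^sup>2) \<le> 1 / 2" using C(1) K H0 by (simp add: field_simps)
    then have "\<delta> * (\<delta> * (K * H * C\<^sup>2)) \<le> \<delta> * (1 / 2)" using \<open>\<delta> > 0\<close> by (intro mult_left_mono) auto
    then show "K * H * (C * \<delta>)\<^sup>2 \<le> \<delta> / 2" by (simp add: power2_eq_square mult_ac)
  qed
  have \<rho>: "\<rho> > 0" "\<rho> \<le> 1" "K * H * \<rho> \<le> \<delta> / 2"
  proof -
    show "\<rho> > 0" "\<rho> \<le> 1" using \<delta>(1) K H0 by (simp_all add: \<rho>_def)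
    have "\<rho> \<le> \<delta> / (2 * K * H)" by (simp add: \<rho>_def)
    then show "K * H * \<rho> \<le> \<delta> / 2" using K H0 by (simp add: field_simps)
  qed
  have "trunc_norm N \<rho> (T z) \<le> \<delta>" if z: "trunc_norm N \<rho> z \<le> \<delta>" for N z
  proof -
    note nonneg = trunc_norm_nonneg[of \<rho> N]
    have mult: "trunc_norm N \<rho> (fps_multiplier e z) \<le> C * \<delta>"
      if "\<And>n. norm (e n) \<le> C" for e
    proof -
      have "trunc_norm N \<rho> (fps_multiplier e z) \<le> C * trunc_norm N \<rho> z"
        using \<rho>(1) that by (intro trunc_norm_multiplier) auto
      also have "\<dots> \<le> C * \<delta>" using z C(1) by (intro mult_left_mono) auto
      finally show ?thesis .
    qed
    have pow: "trunc_norm N \<rho> (fps_multiplier e z ^ m) \<le> (C * \<delta>) ^ m"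
      if "\<And>n. norm (e n) \<le> C" for e m
    proof -
      have "trunc_norm N \<rho> (fps_multiplier e z ^ m) \<le> trunc_norm N \<rho> (fps_multiplier e z) ^ m"
        using \<rho>(1) by (intro trunc_norm_power) simp
      also have "\<dots> \<le> (C * \<delta>) ^ m"
        using \<rho>(1) by (intro power_mono mult that nonneg) auto
      finally show ?thesis .
    qed
    have "trunc_norm N \<rho> (h i * (fps_multiplier f z ^ \<alpha> i * fps_multiplier g z ^ \<beta> i))
        \<le> H * (\<rho> + (C * \<delta>)\<^sup>2)" if i: "i \<in> I" for i
    proof -
      let ?m = "fps_multiplier f z ^ \<alpha> i * fps_multiplier g z ^ \<beta> i"
      have "trunc_norm N \<rho> ?m \<le>
          trunc_norm N \<rho> (fps_multiplier f z ^ \<alpha> i) * trunc_norm N \<rho> (fps_multiplier g z ^ \<beta> i)"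
        using \<rho>(1) by (intro trunc_norm_mult) simp
      also have "\<dots> \<le> (C * \<delta>) ^ \<alpha> i * (C * \<delta>) ^ \<beta> i"
        using \<rho>(1) C \<delta>(1) by (intro mult_mono pow nonneg) auto
      finally have m: "trunc_norm N \<rho> ?m \<le> (C * \<delta>) ^ (\<alpha> i + \<beta> i)" by (simp add: power_add)
      have hm: "trunc_norm N \<rho> (h i * ?m) \<le> trunc_norm N \<rho> (h i) * trunc_norm N \<rho> ?m"
        using \<rho>(1) by (intro trunc_norm_mult) simp
      show ?thesis
      proof (cases "\<alpha> i + \<beta> i < 2")
        case True
        have "(C * \<delta>) ^ (\<alpha> i + \<beta> i) \<le> 1" using C(1) \<delta>(1,2) by (intro power_le_one) auto
        then have "trunc_norm N \<rho> ?m \<le> 1" using m by linarith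
        then have "trunc_norm N \<rho> (h i * ?m) \<le> trunc_norm N \<rho> (h i)"
          using hm mult_left_le[of "trunc_norm N \<rho> ?m" "trunc_norm N \<rho> (h i)"] nonneg[of "h i"] \<rho>(1)
          by linarith
        also have "\<dots> \<le> \<rho> * (\<Sum>n. norm (h i $ n))"
          using i True \<rho>(1,2) by (intro trunc_norm_le_suminf_0 summable_h h_0) auto
        also have "\<dots> \<le> \<rho> * H" using H[OF i] \<rho>(1) by (intro mult_left_mono) auto
        also have "\<dots> \<le> H * (\<rho> + (C * \<delta>)\<^sup>2)" using H0 by (simp add: distrib_left mult.commute)
        finally show ?thesis .
      next
        case False
        then have "(C * \<delta>) ^ (\<alpha> i + \<beta> i) \<le> (C * \<delta>)\<^sup>2"
          using C(1) \<delta>(1,2) by (intro power_decreasing) auto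
        then have m2: "trunc_norm N \<rho> ?m \<le> (C * \<delta>)\<^sup>2" using m by linarith
        have "trunc_norm N \<rho> (h i) \<le> H"
          using trunc_norm_le_suminf[OF summable_h[OF i], of \<rho> N] \<rho>(1,2) H[OF i] by linarith
        then have "trunc_norm N \<rho> (h i) * trunc_norm N \<rho> ?m \<le> H * (C * \<delta>)\<^sup>2"
          using m2 nonneg \<rho>(1) H0 by (intro mult_mono) auto
        also have "\<dots> \<le> H * (\<rho> + (C * \<delta>)\<^sup>2)" using H0 \<rho>(1) by (simp add: distrib_left mult.commute)
        finally show ?thesis using hm by linarith
      qed
    qed
    then have "(\<Sum>i\<in>I. trunc_norm N \<rho> (h i * (fps_multiplier f z ^ \<alpha> i * fps_multiplier g z ^ \<beta> i)))
        \<le> real (card I) * (H * (\<rho> + (C * \<delta>)\<^sup>2))"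
      by (intro sum_bounded_above)
    also have "\<dots> \<le> K * (H * (\<rho> + (C * \<delta>)\<^sup>2))"
      using H0 \<rho> by (intro mult_right_mono) (auto simp: K_def)
    also have "\<dots> = K * H * \<rho> + K * H * (C * \<delta>)\<^sup>2" by (simp add: algebra_simps)
    also have "\<dots> \<le> \<delta>" using \<delta>(3) \<rho>(3) by linarith
    finally have "(\<Sum>i\<in>I. trunc_norm N \<rho> (h i * (fps_multiplier f z ^ \<alpha> i * fps_multiplier g z ^ \<beta> i))) \<le> \<delta>" .
    then show ?thesis
      using trunc_norm_sum[of \<rho> N "\<lambda>i. h i * (fps_multiplier f z ^ \<alpha> i * fps_multiplier g z ^ \<beta> i)" I]
        \<rho>(1) unfolding T_def by linarith
  qed
  then show ?thesis using \<rho>(1) \<delta>(1) by (intro exI[of _ \<rho>] exI[of _ \<delta>] conjI) simp_all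
qed

text \<open>Iterating from 0, contraction freezes the coefficient of degree \<open>j\<close> from
  step \<open>j\<close> on, and the invariant ball of \<open>T_norm_bound\<close> passes to the
  limit.\<close>

lemma fixed_point_exists:
  "\<exists>z. z $ 0 = 0 \<and> T z = z \<and> (\<exists>\<rho>>0. \<exists>B. \<forall>N. trunc_norm N \<rho> z \<le> B)"
proof -
  define Z where "Z n = (T ^^ n) 0" for n
  have Z_Suc: "Z (Suc n) = T (Z n)" and Z_0: "Z 0 = 0" for n by (simp_all add: Z_def)
  have Z_nth_0: "Z n $ 0 = 0" for n
    by (induction n) (simp_all add: Z_0 Z_Suc T_nth_0)
  have step: "fps_X ^ Suc n dvd Z (Suc n) - Z n" for n
  proof (induction n)
    case 0
    then show ?case using Z_nth_0 by (simp add: fps_X_dvd_iff)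
  next
    case (Suc n)
    show ?case using T_contracting[OF Z_nth_0 Z_nth_0 Suc] by (simp only: Z_Suc)
  qed
  have stable: "Z (n + d) $ j = Z n $ j" if "j \<le> n" for n d j
  proof (induction d)
    case (Suc d)
    have "(Z (Suc (n + d)) - Z (n + d)) $ j = 0"
      using step[of "n + d"] that unfolding fps_X_power_dvd_iff by (elim allE[of _ j]) simp
    then show ?case using Suc by simp
  qed simp
  define z where "z = Abs_fps (\<lambda>j. Z j $ j)"
  have z_nth: "z $ j = Z n $ j" if "j \<le> n" for j n
    using stable[of j j "n - j"] that by (simp add: z_def)
  have z_0: "z $ 0 = 0" using Z_nth_0 by (simp add: z_def)
  \<comment> \<open>\<open>z\<close> and \<open>Z j\<close> agree through degree \<open>j\<close>,
    so contraction makes \<open>T z\<close> and \<open>Z (Suc j)\<close> agree there as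
    well.\<close>
  have "T z = z"
  proof (rule fps_ext)
    fix j
    have "fps_X ^ Suc j dvd z - Z j" by (simp add: fps_X_power_dvd_iff z_nth[of _ j] del: power_Suc)
    from T_contracting[OF z_0 Z_nth_0 this] have "fps_X ^ Suc (Suc j) dvd T z - Z (Suc j)"
      by (simp only: Z_Suc)
    then have "(T z - Z (Suc j)) $ j = 0"
      unfolding fps_X_power_dvd_iff by (elim allE[of _ j]) simp
    then show "T z $ j = z $ j" using z_nth[of j "Suc j"] by simp
  qed
  moreover have "\<exists>\<rho>>0. \<exists>B. \<forall>N. trunc_norm N \<rho> z \<le> B"
  proof -
    obtain \<rho> \<delta> where \<rho>: "\<rho> > 0"
      and T: "\<And>N z. trunc_norm N \<rho> z \<le> \<delta> \<Longrightarrow> trunc_norm N \<rho> (T z) \<le> \<delta>"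
      and \<delta>: "\<delta> \<ge> 0"
      using T_norm_bound by metis
    have "trunc_norm N \<rho> (Z n) \<le> \<delta>" for N n
    proof (induction n)
      case 0
      show ?case using \<delta> by (simp add: Z_0 trunc_norm_def)
    qed (simp add: Z_Suc T)
    \<comment> \<open>The truncated norm only sees degrees up to \<open>N\<close>, where
      \<open>z\<close> coincides with the iterate \<open>Z N\<close>.\<close>
    moreover have "trunc_norm N \<rho> z = trunc_norm N \<rho> (Z N)" for N
      unfolding trunc_norm_def by (intro sum.cong) (simp_all add: z_nth[of _ N])
    ultimately show ?thesis using \<rho> by (intro exI[of _ \<rho>] conjI exI[of _ \<delta>]) simp_all
  qed
  ultimately show ?thesis using z_0 by blast
qed

end

section \<open>Nonresonant equations\<close>

lemma sum_binomial_low_degree: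
  fixes c d :: "'a::comm_ring_1"
  shows "(\<Sum>(a, b)\<in>{(a, b) \<in> {..p} \<times> {..q}. a + b < 2}.
      of_nat (p choose a) * c ^ (p - a) * (of_nat (q choose b) * d ^ (q - b)) * (v ^ a * w ^ b)) =
    c ^ p * d ^ q + of_nat p * c ^ (p - 1) * d ^ q * v + of_nat q * c ^ p * d ^ (q - 1) * w"
    (is "sum ?F _ = ?R")
proof -
  \<comment> \<open>If \<open>p\<close> or \<open>q\<close> is 0, a pair on the right lies outside
    the box, but its binomial coefficient is 0.\<close>
  have "sum ?F {(a, b) \<in> {..p} \<times> {..q}. a + b < 2} = sum ?F {(0, 0), (1, 0), (0, 1)}"
    by (rule sum.mono_neutral_left) (auto simp: Suc_le_eq intro!: gr0I)
  also have "\<dots> = ?R" by (simp add: algebra_simps)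
  finally show ?thesis .
qed

text \<open>The last two assumptions prescribe the linear part
  \<open>(D - l * D) * v + D * w\<close> at t = 0. Since \<open>w\<close> is
  \<open>(l + n / K) * v\<close> in degree \<open>n\<close>, this multiplies the coefficient by
  \<open>D * (1 + n / K)\<close>, which never vanishes.\<close>

locale regular_equation =
  fixes I :: "'i set" and B :: "'i \<Rightarrow> complex poly" and p q :: "'i \<Rightarrow> nat"
    and c d D l :: complex and K :: nat
  assumes finite_I: "finite I" and K: "K > 0" and D: "D \<noteq> 0"
    and const_part: "(\<Sum>i\<in>I. coeff (B i) 0 * (c ^ p i * d ^ q i)) = 0"
    and v_part: "(\<Sum>i\<in>I. coeff (B i) 0 * (of_nat (p i) * c ^ (p i - 1) * d ^ q i)) = D - l * D"
    and w_part: "(\<Sum>i\<in>I. coeff (B i) 0 * (of_nat (q i) * c ^ p i * d ^ (q i - 1))) = D"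
begin

text \<open>The multiplier is the operator \<open>l + (t d/dt) / K\<close>. In the application
  \<open>d = l * c\<close>, so the second base is this operator applied to
  \<open>v + c\<close>.\<close>

definition G :: "complex fps \<Rightarrow> complex fps" where
  "G v = (\<Sum>i\<in>I. fps_of_poly (B i) * (v + fps_const c) ^ p i *
     (fps_multiplier (\<lambda>n. l + of_nat n / of_nat K) v + fps_const d) ^ q i)"

definition J :: "('i \<times> nat \<times> nat) set" where
  "J = (SIGMA i:I. {..p i} \<times> {..q i})"

text \<open>Contribution of the i-th summand to the coefficient of \<open>v ^ a * w ^ b\<close> in
  \<open>z - G v / D\<close>. In degree below 2 the part at t = 0 is withheld: these parts add up to
  \<open>D * z\<close>, and what remains is divisible by t.\<close>

definition h :: "'i \<times> nat \<times> nat \<Rightarrow> complex fps" where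
  "h = (\<lambda>(i, a, b). fps_const (- (1 / D) * (of_nat (p i choose a) * c ^ (p i - a) *
       (of_nat (q i choose b) * d ^ (q i - b)))) *
     fps_of_poly (if a + b < 2 then B i - [:coeff (B i) 0:] else B i))"

text \<open>The unknown \<open>z\<close> with \<open>v = fps_multiplier f z\<close> turns the linear part into \<open>D * z\<close>; the
  derivative term \<open>w\<close> is then \<open>fps_multiplier g z\<close>.\<close>

definition f :: "nat \<Rightarrow> complex" where "f n = of_nat K / (of_nat K + of_nat n)"

definition g :: "nat \<Rightarrow> complex" where "g n = (l * of_nat K + of_nat n) / (of_nat K + of_nat n)"

lemma K_add_nonzero: "(of_nat K + of_nat n :: complex) \<noteq> 0"
  using K by (metis add_gr_0 less_numeral_extra(3) of_nat_add of_nat_eq_0_iff)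

sublocale fp: fps_fixed_point J h "\<lambda>(i, a, b). a" "\<lambda>(i, a, b). b" f g "1 + norm l"
proof
  show "finite J" using finite_I by (simp add: J_def)
  show "summable (\<lambda>n. norm (h x $ n))" if "x \<in> J" for x
  proof -
    obtain i a b where x: "x = (i, a, b)" by (cases x) auto
    have "\<exists>y P. h x = fps_const y * fps_of_poly P"
      unfolding x h_def prod.case by blast
    then obtain y P where h: "h x = fps_const y * fps_of_poly P" by blast
    show ?thesis
      by (rule summable_finite[of "{..degree P}"]) (auto simp: h coeff_eq_0)
  qed
  show "h x $ 0 = 0" if "(case x of (i, a, b) \<Rightarrow> a) + (case x of (i, a, b) \<Rightarrow> b) < 2" for x
    using that by (cases x) (auto simp: h_def)
  show "0 < 1 + norm l" by (simp add: add_pos_nonneg)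
  have norm: "norm (of_nat K + of_nat n :: complex) = real (K + n)" for n
    by (metis norm_of_nat of_nat_add)
  show "norm (f n) \<le> 1 + norm l" for n
  proof -
    have "norm (f n) \<le> 1" using K by (simp add: f_def norm_divide norm)
    then show ?thesis by (simp add: add_increasing2)
  qed
  show "norm (g n) \<le> 1 + norm l" for n
  proof -
    have "norm (l * of_nat K + of_nat n) \<le> norm l * K + n"
      by (rule order.trans[OF norm_triangle_ineq]) (simp add: norm_mult)
    also have "\<dots> \<le> (1 + norm l) * real (K + n)" by (simp add: algebra_simps)
    finally show ?thesis using K by (simp add: g_def norm_divide norm field_simps)
  qed
qed

text \<open>Both powers are expanded binomially; by the three assumptions on the coefficients at t =
  0, the low-degree terms withheld from \<open>h\<close> sum to \<open>D * z\<close>.\<close>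

lemma G_multiplier_f:
  "fps_const (1 / D) * G (fps_multiplier f z) = z - fp.T z"
proof -
  define v where "v = fps_multiplier f z"
  define w where "w = fps_multiplier g z"
  define F where "F i a b = of_nat (p i choose a) * fps_const c ^ (p i - a) *
    (of_nat (q i choose b) * fps_const d ^ (q i - b)) * (v ^ a * w ^ b)" for i a b
  have fps_const_sum: "fps_const (sum e I) = (\<Sum>i\<in>I. fps_const (e i))" for e :: "'i \<Rightarrow> complex"
    by (induction I rule: infinite_finite_induct) (simp_all flip: fps_const_add)
  have w: "fps_multiplier (\<lambda>n. l + of_nat n / of_nat K) v = w"
  proof (rule fps_ext)
    fix n
    have "(l + of_nat n / of_nat K) * of_nat K = l * of_nat K + of_nat n"
      using K by (simp add: distrib_right)
    then have "(l + of_nat n / of_nat K) * f n = g n"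
      unfolding f_def g_def times_divide_eq_right by simp
    then show "fps_multiplier (\<lambda>n. l + of_nat n / of_nat K) v $ n = w $ n"
      by (simp add: v_def w_def flip: mult.assoc)
  qed
  have expand: "(v + fps_const c) ^ p i * (w + fps_const d) ^ q i =
      (\<Sum>(a, b)\<in>{..p i} \<times> {..q i}. F i a b)" for i
    unfolding binomial_ring sum_product sum.cartesian_product F_def by (simp add: mult_ac)
  have low: "(\<Sum>(a, b)\<in>{..p i} \<times> {..q i}. if a + b < 2 then F i a b else 0) =
      fps_const c ^ p i * fps_const d ^ q i
        + of_nat (p i) * fps_const c ^ (p i - 1) * fps_const d ^ q i * v
        + of_nat (q i) * fps_const c ^ p i * fps_const d ^ (q i - 1) * w" for i
  proof -
    have "(\<Sum>(a, b)\<in>{..p i} \<times> {..q i}. if a + b < 2 then F i a b else 0) =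
        (\<Sum>(a, b)\<in>{(a, b) \<in> {..p i} \<times> {..q i}. a + b < 2}. F i a b)"
      by (rule sum.mono_neutral_cong_right) (auto split: if_splits)
    then show ?thesis unfolding F_def sum_binomial_low_degree .
  qed
  have h: "h (i, a, b) * (v ^ a * w ^ b) = - fps_const (1 / D) *
      (fps_of_poly (B i) * F i a b - fps_const (coeff (B i) 0) * (if a + b < 2 then F i a b else 0))"
    for i a b
  proof -
    define Y where "Y = of_nat (p i choose a) * c ^ (p i - a) * (of_nat (q i choose b) * d ^ (q i - b))"
    have F: "F i a b = fps_const Y * (v ^ a * w ^ b)"
      unfolding F_def Y_def fps_const_mult[symmetric] fps_const_power[symmetric] fps_of_nat ..
    have "h (i, a, b) = - fps_const (1 / D) * fps_const Y *
        fps_of_poly (if a + b < 2 then B i - [:coeff (B i) 0:] else B i)"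
      by (simp add: h_def Y_def)
    then show ?thesis
      by (simp add: F fps_of_poly_diff fps_of_poly_const algebra_simps del: fps_const_mult)
  qed
  have "fp.T z = (\<Sum>i\<in>I. \<Sum>(a, b)\<in>{..p i} \<times> {..q i}. h (i, a, b) * (v ^ a * w ^ b))"
    unfolding fp.T_def unfolding J_def v_def w_def
    by (subst sum.Sigma) (use finite_I in \<open>auto simp: case_prod_beta\<close>)
  also have "\<dots> = - fps_const (1 / D) * (\<Sum>i\<in>I. fps_of_poly (B i) *
      (\<Sum>(a, b)\<in>{..p i} \<times> {..q i}. F i a b) - fps_const (coeff (B i) 0) *
      (\<Sum>(a, b)\<in>{..p i} \<times> {..q i}. if a + b < 2 then F i a b else 0))"
    unfolding h case_prod_beta sum_distrib_left sum_subtractf[symmetric] by simp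
  also have "\<dots> = - fps_const (1 / D) * G v + fps_const (1 / D) *
      (\<Sum>i\<in>I. fps_const (coeff (B i) 0) * (fps_const c ^ p i * fps_const d ^ q i
        + of_nat (p i) * fps_const c ^ (p i - 1) * fps_const d ^ q i * v
        + of_nat (q i) * fps_const c ^ p i * fps_const d ^ (q i - 1) * w))"
    unfolding expand[symmetric] low G_def w sum_subtractf right_diff_distrib
    by (simp only: mult_minus_left diff_minus_eq_add mult.assoc)
  also have "(\<Sum>i\<in>I. fps_const (coeff (B i) 0) * (fps_const c ^ p i * fps_const d ^ q i
        + of_nat (p i) * fps_const c ^ (p i - 1) * fps_const d ^ q i * v
        + of_nat (q i) * fps_const c ^ p i * fps_const d ^ (q i - 1) * w)) =
      fps_const (\<Sum>i\<in>I. coeff (B i) 0 * (c ^ p i * d ^ q i))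
      + fps_const (\<Sum>i\<in>I. coeff (B i) 0 * (of_nat (p i) * c ^ (p i - 1) * d ^ q i)) * v
      + fps_const (\<Sum>i\<in>I. coeff (B i) 0 * (of_nat (q i) * c ^ p i * d ^ (q i - 1))) * w"
    unfolding fps_const_sum sum_distrib_right sum.distrib[symmetric] fps_const_mult[symmetric]
      fps_const_power[symmetric] fps_of_nat
    by (simp only: distrib_left mult_ac)
  also have "\<dots> = fps_const (D - l * D) * v + fps_const D * w"
    unfolding const_part v_part w_part by simp
  also have "\<dots> = fps_const D * z"
  proof (rule fps_ext)
    fix n
    \<comment> \<open>\<open>f n\<close> is the inverse of \<open>1 + n / K\<close>, and
      \<open>g n = (l + n / K) * f n\<close>.\<close>
    have "(1 - l) * f n + g n = 1" 
      using K_add_nonzero[of n] unfolding f_def g_def times_divide_eq_right add_divide_distrib[symmetric]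
      by (simp add: left_diff_distrib)
    then have "D * ((1 - l) * f n + g n) * z $ n = D * z $ n" by simp
    then show "(fps_const (D - l * D) * v + fps_const D * w) $ n = (fps_const D * z) $ n"
      by (simp add: v_def w_def algebra_simps)
  qed
  also have "fps_const (1 / D) * (fps_const D * z) = z"
    using D by (simp flip: mult.assoc)
  finally show ?thesis by (simp add: v_def del: fps_const_neg)
qed

lemma G_multiplier_f_eq_0_iff: "G (fps_multiplier f z) = 0 \<longleftrightarrow> fp.T z = z"
  using G_multiplier_f[of z] D by (metis divide_eq_0_iff eq_iff_diff_eq_0 fps_const_eq_0_iff mult_eq_0_iff one_neq_zero)

text \<open>\<open>f\<close> has no zero, so the substitution \<open>v = fps_multiplier f z\<close>
  reaches every \<open>v\<close>; this carries uniqueness over from \<open>z\<close>.\<close>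

lemma multiplier_f_inverse: "fps_multiplier f (fps_multiplier (\<lambda>n. 1 / f n) v) = v"
proof -
  have "f n \<noteq> 0" for n using K_add_nonzero[of n] K by (simp add: f_def)
  then show ?thesis by (simp add: fps_eq_iff)
qed

lemma solution_unique:
  assumes "v $ 0 = 0" "G v = 0" "v' $ 0 = 0" "G v' = 0"
  shows "v = v'"
proof -
  have "fps_multiplier (\<lambda>n. 1 / f n) v = fps_multiplier (\<lambda>n. 1 / f n) v'"
    by (rule fp.fixed_point_unique)
      (use assms in \<open>simp_all add: multiplier_f_inverse flip: G_multiplier_f_eq_0_iff\<close>)
  then show ?thesis using multiplier_f_inverse by metis
qed

lemma solution_exists: "\<exists>v. v $ 0 = 0 \<and> G v = 0 \<and> fps_conv_radius v > 0"
proof -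
  obtain z \<rho> B where z: "z $ 0 = 0" "fp.T z = z" and \<rho>: "\<rho> > 0" "\<And>N. trunc_norm N \<rho> z \<le> B"
    using fp.fixed_point_exists by blast
  have "norm (f n) \<le> 1" for n
  proof -
    have "norm (f n) = real K / real (K + n)"
      unfolding f_def norm_divide by (metis norm_of_nat of_nat_add)
    then show ?thesis using K by simp
  qed
  then have "trunc_norm N \<rho> (fps_multiplier f z) \<le> B" for N
    using trunc_norm_multiplier[of \<rho> f 1 N z] \<rho>(1) \<rho>(2)[of N] by simp
  then have "fps_conv_radius (fps_multiplier f z) > 0"
    by (rule fps_conv_radius_pos_if_trunc_norm_bounded[OF \<rho>(1)])
  moreover have "G (fps_multiplier f z) = 0" using z(2) G_multiplier_f_eq_0_iff by simp
  ultimately show ?thesis using z(1) by (intro exI[of _ "fps_multiplier f z"]) simp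
qed

end

section \<open>Puiseux series as Laurent series in a root\<close>

lemma puiseux_of_fls_power:
  "k > 0 \<Longrightarrow> puiseux_of_fls k (L ^ m) = puiseux_of_fls k L ^ m"
  by (induction m) (simp_all add: puiseux_of_fls_1 puiseux_of_fls_mult)

lemma puiseux_of_fls_sum:
  "k > 0 \<Longrightarrow> puiseux_of_fls k (\<Sum>i\<in>I. L i) = (\<Sum>i\<in>I. puiseux_of_fls k (L i))"
  by (induction I rule: infinite_finite_induct)
    (simp_all add: puiseux_of_fls_0 puiseux_of_fls_add)

lemma puiseux_of_fls_eq_0_iff:
  assumes "k > 0"
  shows "puiseux_of_fls k L = 0 \<longleftrightarrow> L = 0"
proof
  assume "puiseux_of_fls k L = 0"
  then have "fls_nth L m = 0" for m
    using puiseux_coeff_of_fls_frac[OF assms, of L m] by simp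
  then show "L = 0" by (simp add: fls_eq_iff)
qed (simp add: puiseux_of_fls_0 assms)

text \<open>In terms of t, \<open>x\<close> is \<open>x0 + t ^ k\<close>; the identity follows the
  Horner recursion of \<open>P\<close>.\<close>

lemma expand_at_conv_puiseux_of_fls:
  assumes k: "k > 0"
  shows "expand_at x0 P = puiseux_of_fls k (fps_to_fls (fps_of_poly (pcompose P (monom 1 k + [:x0:]))))"
proof -
  have const: "puiseux_const y = puiseux_of_fls k (fls_const y)" for y
    by (rule puiseux_of_fls_eqI) (use k in auto)
  have const_0: "puiseux_const 0 = 0" by (simp add: zero_puiseux_def)
  have X: "puiseux_monom 1 1 = puiseux_of_fls k (fls_X ^ k)"
  proof (rule puiseux_of_fls_eqI)
    show "puiseux_coeff (puiseux_monom 1 1) (of_int m / of_nat k) = fls_nth (fls_X ^ k) m" for m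
    proof -
      have "(of_int m / of_nat k = (1 :: rat)) \<longleftrightarrow> of_int m = (of_int (int k) :: rat)"
        using k by (auto simp add: field_simps)
      then show ?thesis by (simp add: fls_X_power_nth)
    qed
  qed (use k in auto)
  show ?thesis
    unfolding expand_at_def
  proof (induction P)
    case 0
    then show ?case by (simp add: puiseux_of_fls_0 k)
  next
    case (pCons y P)
    have "fps_to_fls (fps_of_poly (pcompose (pCons y P) (monom 1 k + [:x0:]))) =
        fls_const y + (fls_const x0 + fls_X ^ k) *
          fps_to_fls (fps_of_poly (pcompose P (monom 1 k + [:x0:])))"
      by (simp add: pcompose_pCons fps_of_poly_add fps_of_poly_mult fps_of_poly_const
          fps_of_poly_monom' fls_times_fps_to_fls fps_to_fls_power add.commute)
    moreover have "map_poly puiseux_const (pCons y P) = pCons (puiseux_const y) (map_poly puiseux_const P)"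
      by (rule map_poly_pCons) (simp add: const_0)
    ultimately show ?case
      by (simp only: poly_pCons pCons.IH)
        (simp only: const X puiseux_of_fls_add[OF k] puiseux_of_fls_mult[OF k])
  qed
qed

text \<open>Termwise, \<open>t ^ (R + j) = (x - x0) ^ (lam + j / k)\<close> has derivative
  \<open>(lam + j / k) * t ^ (R + j - k)\<close>. As \<open>fls_shift\<close> lowers exponents, the
  factor \<open>t ^ (R - k)\<close> appears as a shift by \<open>int k - R\<close>.\<close>

lemma puiseux_deriv_of_fls_shift:
  assumes k: "k > 0" and lam: "of_nat k * lam = of_int R"
  shows "puiseux_deriv (puiseux_of_fls k (fls_shift (- R) (fps_to_fls u))) =
    puiseux_of_fls k (fls_shift (int k - R)
      (fps_to_fls (fps_multiplier (\<lambda>m. of_rat lam + of_nat m / of_nat k) u)))"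
proof (rule puiseux_of_fls_eqI[OF k])
  have lam': "lam = of_int R / of_nat k" using k lam by (simp add: field_simps)
  show "puiseux_coeff (puiseux_deriv (puiseux_of_fls k (fls_shift (- R) (fps_to_fls u)))) (of_int m / of_nat k) =
    fls_nth (fls_shift (int k - R)
      (fps_to_fls (fps_multiplier (\<lambda>m. of_rat lam + of_nat m / of_nat k) u))) m" for m
  proof -
    have m1: "of_int m / of_nat k + 1 = (of_int (m + int k) / of_nat k :: rat)"
      using k by (simp add: field_simps)
    show ?thesis
    proof (cases "m + int k - R \<ge> 0")
      case True
      then obtain j where j: "m + int k - R = int j" using nonneg_int_cases by blast
      then have mk: "m + int k = R + int j" by simp
      have c: "of_rat (of_int (m + int k) / of_nat k) = (of_rat lam + of_nat j / of_nat k :: complex)"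
        unfolding mk by (simp add: lam' of_rat_divide of_rat_add add_divide_distrib)
      then show ?thesis
        unfolding puiseux_coeff_deriv m1 puiseux_coeff_of_fls_frac[OF k] c
        by (simp add: mk add_diff_eq)
    next
      case False
      then show ?thesis
        unfolding puiseux_coeff_deriv m1 puiseux_coeff_of_fls_frac[OF k] by simp
    qed
  qed
  show "puiseux_coeff (puiseux_deriv (puiseux_of_fls k (fls_shift (- R) (fps_to_fls u)))) e = 0"
    if "of_nat k * e \<notin> \<int>" for e
  proof -
    have "of_nat k * (e + 1) \<notin> \<int>"
    proof
      assume "of_nat k * (e + 1) \<in> \<int>"
      then have "of_nat k * (e + 1) - of_nat k \<in> \<int>" by (rule Ints_diff) simp
      then show False using that by (simp add: algebra_simps)
    qed
    then show ?thesis using k by (simp add: puiseux_coeff_of_fls)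
  qed
qed

lemma has_first_term_of_fls_shift:
  assumes k: "k > 0" and lam: "of_nat k * lam = of_int R" and "u $ 0 \<noteq> 0"
  shows "has_first_term (puiseux_of_fls k (fls_shift (- R) (fps_to_fls u))) (u $ 0) lam"
  unfolding has_first_term_def
proof (intro conjI allI impI)
  show "puiseux_coeff (puiseux_of_fls k (fls_shift (- R) (fps_to_fls u))) lam = u $ 0"
    using k by (simp add: puiseux_coeff_of_fls lam)
  fix e assume "e < lam"
  then have "of_nat k * e < of_int R" using k by (simp flip: lam)
  then show "puiseux_coeff (puiseux_of_fls k (fls_shift (- R) (fps_to_fls u))) e = 0"
    using k by (auto simp: puiseux_coeff_of_fls elim!: Ints_cases)
qed (fact assms)

lemma has_first_term_of_flsE:
  assumes k: "k > 0" and lam: "of_nat k * lam = of_int R"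
    and first: "has_first_term (puiseux_of_fls k L) c lam"
  obtains u where "u $ 0 = c" "L = fls_shift (- R) (fps_to_fls u)"
proof
  define u where "u = Abs_fps (\<lambda>m. fls_nth L (R + int m))"
  have lam': "lam = of_int R / of_nat k" using k lam by (simp add: field_simps)
  show "u $ 0 = c"
    using first k by (simp add: u_def has_first_term_def lam')
  have "fls_nth L m = 0" if "m < R" for m
  proof -
    have "of_int m / of_nat k < lam" using that k by (simp add: lam' divide_strict_right_mono)
    then show ?thesis
      using first puiseux_coeff_of_fls_frac[OF k, of L m] by (simp add: has_first_term_def)
  qed
  then show "L = fls_shift (- R) (fps_to_fls u)"
    by (auto simp: fls_eq_iff u_def)
qed

text \<open>The term points lie in the hull, so its minimum bounds their values; one that attains
  the value of a minimizer is itself a minimizer.\<close>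

lemma edge_terms_iff:
  assumes "i0 \<in> edge_terms n p q l" "i \<in> {1..n}"
  shows "l * real (p i0 + q i0) - real (q i0) \<le> l * real (p i + q i) - real (q i)"
    and "i \<in> edge_terms n p q l \<longleftrightarrow>
      l * real (p i + q i) - real (q i) = l * real (p i0 + q i0) - real (q i0)"
proof -
  have hull: "term_point p q j \<in> convex hull (term_point p q ` {1..n})" if "j \<in> {1..n}" for j
    using that by (simp add: hull_inc)
  have le: "l * real (p j + q j) - real (q j) \<le> l * real (p i + q i) - real (q i)"
    if "j \<in> edge_terms n p q l" "i \<in> {1..n}" for i j
    using that hull[of i]
    by (auto simp: edge_terms_def newton_face_def Let_def term_point_def)
  show "l * real (p i0 + q i0) - real (q i0) \<le> l * real (p i + q i) - real (q i)"
    by (rule le[OF assms])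
  show "i \<in> edge_terms n p q l \<longleftrightarrow>
      l * real (p i + q i) - real (q i) = l * real (p i0 + q i0) - real (q i0)"
  proof
    assume "i \<in> edge_terms n p q l"
    moreover have "i0 \<in> {1..n}" using assms(1) by (simp add: edge_terms_def)
    ultimately show "l * real (p i + q i) - real (q i) = l * real (p i0 + q i0) - real (q i0)"
      using le[of i i0] le[OF assms] by linarith
  next
    assume "l * real (p i + q i) - real (q i) = l * real (p i0 + q i0) - real (q i0)"
    then show "i \<in> edge_terms n p q l"
      using assms hull[OF assms(2)]
      by (auto simp: edge_terms_def newton_face_def Let_def term_point_def)
  qed
qed

text \<open>Writing \<open>P = (X - c) * Q\<close> with \<open>Q\<close> nonzero at
  \<open>c\<close>, the derivative at \<open>c\<close> is the value of \<open>Q\<close>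
  there.\<close>

lemma poly_pderiv_nonzero_if_order_1:
  fixes P :: "complex poly"
  assumes "P \<noteq> 0" "order c P = 1"
  shows "poly P c = 0" "poly (pderiv P) c \<noteq> 0"
proof -
  obtain Q where Q: "P = [:- c, 1:] * Q" "\<not> [:- c, 1:] dvd Q"
    using order_decomp[OF assms(1), of c] assms(2) by auto
  then have "poly Q c \<noteq> 0" by (simp add: poly_eq_0_iff_dvd)
  then show "poly P c = 0" "poly (pderiv P) c \<noteq> 0"
    unfolding Q(1) pderiv_mult by (simp_all add: pderiv_pCons)
qed

section \<open>The equation at an edge\<close>

lemma fps_to_fls_sum: "fps_to_fls (sum f I) = (\<Sum>i\<in>I. fps_to_fls (f i))"
  by (induction I rule: infinite_finite_induct) simp_all

text \<open>\<open>K\<close> is an arbitrary denominator for \<open>lam\<close>, not just the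
  reduced one: a competing solution may involve other roots of \<open>x - x0\<close>, and uniqueness
  has to be tested in a common one.\<close>

locale puiseux_edge_equation =
  fixes n :: nat and a :: "nat \<Rightarrow> complex poly" and p q :: "nat \<Rightarrow> nat"
    and x0 c :: complex and lam :: rat and K :: nat and R :: int
  assumes K: "K > 0" and lam: "of_nat K * lam = of_int R" and lam_nonzero: "lam \<noteq> 0"
    and c_nonzero: "c \<noteq> 0"
    and char_nonzero: "char_poly n a p q x0 lam \<noteq> 0"
    and char_order: "order c (char_poly n a p q x0 lam) = 1"
begin

abbreviation edge :: "nat set" where "edge \<equiv> edge_terms n p q (of_rat lam)"

definition D :: complex where "D = poly (pderiv (char_poly n a p q x0 lam)) c"

text \<open>The order in \<open>t\<close> of the \<open>i\<close>-th term after the substitution, and its minimum.\<close>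

definition E :: "nat \<Rightarrow> int" where "E i = R * int (p i + q i) - int K * int (q i)"

definition m :: int where "m = E (SOME i. i \<in> edge)"

text \<open>Coefficient of the i-th term in t once the common factor \<open>t ^ m\<close> is divided
  out.\<close>

definition B :: "nat \<Rightarrow> complex poly" where
  "B i = pcompose (a i) (monom 1 K + [:x0:]) * monom 1 (nat (E i - m))"

section \<open>The edge and the characteristic polynomial at t = 0\<close>

lemma edge_subset: "edge \<subseteq> {1..n}" and finite_edge: "finite edge"
  by (auto simp: edge_terms_def)

text \<open>\<open>E i\<close> is \<open>K\<close> times the value of \<open>lam * X - Y\<close> at
  the i-th point, so minimal order in t means lying on the edge.\<close>

lemma E_minimal:
  assumes "i \<in> {1..n}"
  shows "m \<le> E i" and "i \<in> edge \<longleftrightarrow> E i = m"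
proof -
  define i0 where "i0 = (SOME i. i \<in> edge)"
  \<comment> \<open>An empty edge would make the characteristic polynomial 0.\<close>
  have "edge \<noteq> {}" using char_nonzero unfolding char_poly_def by force
  then have i0: "i0 \<in> edge" unfolding i0_def by (simp add: some_in_eq)
  have "real_of_rat (of_nat K * lam) = real_of_int R" by (simp add: lam)
  then have lam': "real K * of_rat lam = real_of_int R" by (simp add: of_rat_mult)
  have E: "real_of_int (E i) = real K * (of_rat lam * real (p i + q i) - real (q i))" for i
    unfolding E_def right_diff_distrib mult.assoc[symmetric] lam' by simp
  have m: "m = E i0" by (simp add: m_def i0_def)
  have "real_of_int m \<le> real_of_int (E i)"
    unfolding m E using edge_terms_iff(1)[OF i0 assms] by (intro mult_left_mono) auto
  then show "m \<le> E i" by simp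
  have "i \<in> edge \<longleftrightarrow> real_of_int (E i) = real_of_int m"
    unfolding m E edge_terms_iff(2)[OF i0 assms] using K by simp
  then show "i \<in> edge \<longleftrightarrow> E i = m" by simp
qed

lemma coeff_B_0:
  assumes "i \<in> {1..n}"
  shows "coeff (B i) 0 = (if i \<in> edge then poly (a i) x0 else 0)"
proof -
  have "coeff (B i) 0 = poly (B i) 0" by (simp add: poly_0_coeff_0)
  also have "\<dots> = poly (a i) x0 * 0 ^ nat (E i - m)"
    using K by (simp add: B_def poly_pcompose poly_monom zero_power)
  finally show ?thesis using E_minimal[OF assms] by (simp add: zero_power)
qed

lemma sum_coeff_B_0:
  "(\<Sum>i=1..n. coeff (B i) 0 * f i) = (\<Sum>i\<in>edge. poly (a i) x0 * f i)"
  using edge_subset coeff_B_0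
  by (intro sum.mono_neutral_cong_right) (auto simp: finite_edge)

lemma char_root: "(\<Sum>i\<in>edge. poly (a i) x0 * (of_rat lam ^ q i * c ^ (p i + q i))) = 0"
  using poly_pderiv_nonzero_if_order_1(1)[OF char_nonzero char_order]
  by (simp add: char_poly_def poly_sum poly_monom mult_ac)

lemma D_nonzero: "D \<noteq> 0"
  unfolding D_def by (rule poly_pderiv_nonzero_if_order_1(2)[OF char_nonzero char_order])

text \<open>The factor \<open>c\<close> restores the exponent lowered by differentiation, so no
  truncated subtraction remains.\<close>

lemma c_times_D:
  "c * D = (\<Sum>i\<in>edge. poly (a i) x0 * (of_nat (p i + q i) * (of_rat lam ^ q i * c ^ (p i + q i))))"
proof -
  have "D = (\<Sum>i\<in>edge. of_nat (p i + q i) * (poly (a i) x0 * of_rat lam ^ q i) * c ^ (p i + q i - 1))"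
    by (simp add: D_def char_poly_def higher_pderiv_sum[of 1, simplified] pderiv_monom poly_sum poly_monom)
  moreover have "c * (of_nat k * x * c ^ (k - 1)) = x * (of_nat k * c ^ k)" for k x
    by (cases k) (simp_all add: mult_ac)
  ultimately have "c * D = (\<Sum>i\<in>edge. poly (a i) x0 * of_rat lam ^ q i * (of_nat (p i + q i) * c ^ (p i + q i)))"
    by (simp only: sum_distrib_left)
  then show ?thesis by (simp only: mult_ac)
qed

text \<open>On the edge \<open>N = \<lambda> M - m / K\<close>, and the constant \<open>m / K\<close> contributes a multiple of the
  characteristic polynomial at its root \<open>c\<close>.\<close>

lemma sum_edge_q:
  "(\<Sum>i\<in>edge. poly (a i) x0 * (of_nat (q i) * (of_rat lam ^ q i * c ^ (p i + q i)))) = of_rat lam * (c * D)"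
proof -
  have lam': "of_nat K * of_rat lam = (of_int R :: complex)"
    by (metis lam of_rat_mult of_rat_of_int_eq of_rat_of_nat_eq)
  have q: "of_nat (q i) = of_rat lam * of_nat (p i + q i) - (of_int m / of_nat K :: complex)"
    if "i \<in> edge" for i
  proof -
    have "E i = m" using that edge_subset E_minimal(2) by blast
    then have "int K * int (q i) = R * int (p i + q i) - m" by (simp add: E_def)
    then have "of_int (int K * int (q i)) = (of_int (R * int (p i + q i) - m) :: complex)" by simp
    then have "of_nat K * of_nat (q i) = of_nat K * of_rat lam * of_nat (p i + q i) - (of_int m :: complex)"
      by (simp add: lam')
    then show ?thesis using K by (simp add: field_simps)
  qed
  have "(\<Sum>i\<in>edge. poly (a i) x0 * (of_nat (q i) * (of_rat lam ^ q i * c ^ (p i + q i)))) =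
      (\<Sum>i\<in>edge. of_rat lam * (poly (a i) x0 * (of_nat (p i + q i) * (of_rat lam ^ q i * c ^ (p i + q i))))
        - of_int m / of_nat K * (poly (a i) x0 * (of_rat lam ^ q i * c ^ (p i + q i))))"
    by (rule sum.cong) (simp_all only: q ring_distribs mult_ac)
  also have "\<dots> = of_rat lam * (c * D)"
    unfolding sum_subtractf sum_distrib_left[symmetric] char_root c_times_D by simp
  finally show ?thesis .
qed

text \<open>\<open>const_part\<close> is \<open>char_root\<close>. The other two are proved after
  multiplication by the nonzero \<open>lam * c\<close> and \<open>c\<close>: \<open>w_part\<close>
  becomes \<open>sum_edge_q\<close>, and \<open>v_part\<close> follows from it and
  \<open>c_times_D\<close> because \<open>p = (p + q) - q\<close>.\<close>

sublocale reg: regular_equation "{1..n}" B p q c "of_rat lam * c" D "of_rat lam" K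
proof
  have lc: "of_rat lam * c \<noteq> 0" using lam_nonzero c_nonzero by simp
  show "(\<Sum>i=1..n. coeff (B i) 0 * (c ^ p i * (of_rat lam * c) ^ q i)) = 0"
    unfolding sum_coeff_B_0 char_root[symmetric]
    by (simp add: power_mult_distrib power_add mult_ac)
  have q: "of_rat lam * c * (of_nat (q i) * c ^ p i * (of_rat lam * c) ^ (q i - 1)) =
      of_nat (q i) * (of_rat lam ^ q i * c ^ (p i + q i))" for i
    by (cases "q i") (simp_all add: power_mult_distrib power_add mult_ac)
  have "of_rat lam * c * (\<Sum>i=1..n. coeff (B i) 0 * (of_nat (q i) * c ^ p i * (of_rat lam * c) ^ (q i - 1)))
      = of_rat lam * c * D"
    unfolding sum_coeff_B_0 sum_distrib_left mult.left_commute[of "of_rat lam * c" "poly _ _"] q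
    by (simp only: sum_edge_q mult.assoc)
  then show "(\<Sum>i=1..n. coeff (B i) 0 * (of_nat (q i) * c ^ p i * (of_rat lam * c) ^ (q i - 1))) = D"
    using lc by simp
  have p: "c * (of_nat (p i) * c ^ (p i - 1) * (of_rat lam * c) ^ q i) =
      of_nat (p i + q i) * (of_rat lam ^ q i * c ^ (p i + q i))
      - of_nat (q i) * (of_rat lam ^ q i * c ^ (p i + q i))" for i
    by (cases "p i") (simp_all add: power_mult_distrib power_add algebra_simps)
  have "c * (\<Sum>i=1..n. coeff (B i) 0 * (of_nat (p i) * c ^ (p i - 1) * (of_rat lam * c) ^ q i))
      = c * (D - of_rat lam * D)"
    unfolding sum_coeff_B_0 sum_distrib_left mult.left_commute[of c "poly _ _"] p right_diff_distrib
      sum_subtractf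
    by (simp only: sum_edge_q c_times_D[symmetric] mult.left_commute[of c "of_rat lam"])
  then show "(\<Sum>i=1..n. coeff (B i) 0 * (of_nat (p i) * c ^ (p i - 1) * (of_rat lam * c) ^ q i))
      = D - of_rat lam * D"
    using c_nonzero by simp
qed (use K D_nonzero in auto)

text \<open>With \<open>y = t ^ R * u\<close> and derivative \<open>t ^ (R - K) * w\<close>, the
  i-th term has the factor \<open>t ^ E i\<close>. Dividing by \<open>t ^ m\<close>, a unit among
  Laurent series, leaves \<open>reg.G\<close>.\<close>

lemma ode_lhs_eq_0_iff:
  assumes "u $ 0 = c"
  shows "ode_lhs n a p q x0 (puiseux_of_fls K (fls_shift (- R) (fps_to_fls u))) = 0 \<longleftrightarrow>
    reg.G (u - fps_const c) = 0"
proof -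
  define w where "w = fps_multiplier (\<lambda>j. of_rat lam + of_nat j / of_nat K) u"
  define A where "A i = fps_of_poly (pcompose (a i) (monom 1 K + [:x0:]))" for i
  \<comment> \<open>In degree 0 the multiplier is \<open>lam\<close>, so it sends the constant
    \<open>c\<close> to \<open>lam * c\<close>.\<close>
  have w: "fps_multiplier (\<lambda>j. of_rat lam + of_nat j / of_nat K) (u - fps_const c)
      + fps_const (of_rat lam * c) = w"
  proof (rule fps_ext)
    show "(fps_multiplier (\<lambda>j. of_rat lam + of_nat j / of_nat K) (u - fps_const c)
      + fps_const (of_rat lam * c)) $ j = w $ j" for j
      using assms by (cases j) (simp_all add: w_def)
  qed
  have G: "reg.G (u - fps_const c) = (\<Sum>i=1..n. fps_X ^ nat (E i - m) * (A i * u ^ p i * w ^ q i))"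
    unfolding reg.G_def w by (simp add: B_def A_def fps_of_poly_mult fps_of_poly_monom' mult_ac)
  have "fps_to_fls (A i) * fls_shift (- R) (fps_to_fls u) ^ p i * fls_shift (int K - R) (fps_to_fls w) ^ q i
      = fls_X_intpow m * fps_to_fls (fps_X ^ nat (E i - m) * (A i * u ^ p i * w ^ q i))"
    if "i \<in> {1..n}" for i
  proof -
    have "fls_X_intpow R ^ p i * fls_X_intpow (R - int K) ^ q i =
        fls_X_intpow m * (fls_X ^ nat (E i - m) :: complex fls)"
      unfolding fls_X_intpow_power fls_X_intpow_times_fls_X_intpow fls_X_power_conv_shift_1
      using E_minimal(1)[OF that]
      by (simp add: E_def algebra_simps)
    moreover have "fls_shift (- R) (fps_to_fls u) = fls_X_intpow R * fps_to_fls u"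
      "fls_shift (int K - R) (fps_to_fls w) = fls_X_intpow (R - int K) * fps_to_fls w"
      unfolding fls_X_intpow_times_conv_shift by (simp_all only: minus_diff_eq)
    moreover have "F * (x * U) ^ p i * (y * W) ^ q i = x ^ p i * y ^ q i * (F * U ^ p i * W ^ q i)"
      for F x y U W :: "complex fls"
      by (simp only: power_mult_distrib mult_ac)
    ultimately show ?thesis
      by (simp only: fls_times_fps_to_fls fps_to_fls_power fps_X_to_fls
          mult.assoc[of "fls_X_intpow m"])
  qed
  then have "ode_lhs n a p q x0 (puiseux_of_fls K (fls_shift (- R) (fps_to_fls u))) =
      puiseux_of_fls K (\<Sum>i=1..n. fls_X_intpow m * fps_to_fls (fps_X ^ nat (E i - m) * (A i * u ^ p i * w ^ q i)))"
    unfolding ode_lhs_def expand_at_conv_puiseux_of_fls[OF K] puiseux_deriv_of_fls_shift[OF K lam]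
      puiseux_of_fls_sum[OF K] puiseux_of_fls_power[OF K, symmetric] puiseux_of_fls_mult[OF K, symmetric]
      A_def w_def by simp
  also have "\<dots> = puiseux_of_fls K (fls_X_intpow m * fps_to_fls (reg.G (u - fps_const c)))"
    unfolding G sum_distrib_left[symmetric] fps_to_fls_sum ..
  finally show ?thesis by (simp add: puiseux_of_fls_eq_0_iff K)
qed

lemma puiseux_solution_unique:
  assumes "has_first_term (puiseux_of_fls K L) c lam" "ode_lhs n a p q x0 (puiseux_of_fls K L) = 0"
    and "has_first_term (puiseux_of_fls K L') c lam" "ode_lhs n a p q x0 (puiseux_of_fls K L') = 0"
  shows "L = L'"
proof -
  obtain u where u: "u $ 0 = c" "L = fls_shift (- R) (fps_to_fls u)"
    using assms(1) by (rule has_first_term_of_flsE[OF K lam])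
  obtain u' where u': "u' $ 0 = c" "L' = fls_shift (- R) (fps_to_fls u')"
    using assms(3) by (rule has_first_term_of_flsE[OF K lam])
  have "u - fps_const c = u' - fps_const c"
    by (rule reg.solution_unique)
      (use assms(2,4) u u' ode_lhs_eq_0_iff[OF u(1)] ode_lhs_eq_0_iff[OF u'(1)] in simp_all)
  then show ?thesis by (simp add: u(2) u'(2))
qed

lemma puiseux_solution_exists:
  "\<exists>L. has_first_term (puiseux_of_fls K L) c lam \<and> ode_lhs n a p q x0 (puiseux_of_fls K L) = 0 \<and>
    fls_conv_radius L > 0"
proof -
  obtain v where v: "v $ 0 = 0" "reg.G v = 0" "fps_conv_radius v > 0"
    using reg.solution_exists by blast
  define u where "u = v + fps_const c"
  have u: "u $ 0 = c" "u - fps_const c = v" using v(1) by (simp_all add: u_def)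
  have "fps_conv_radius u \<ge> min (fps_conv_radius v) (fps_conv_radius (fps_const c))"
    unfolding u_def by (rule fps_conv_radius_add)
  then have "fps_conv_radius u > 0" using v(3) by (simp add: min_def split: if_splits)
  moreover have "ode_lhs n a p q x0 (puiseux_of_fls K (fls_shift (- R) (fps_to_fls u))) = 0"
    using v(2) u by (simp add: ode_lhs_eq_0_iff)
  moreover have "has_first_term (puiseux_of_fls K (fls_shift (- R) (fps_to_fls u))) c lam"
    using has_first_term_of_fls_shift[OF K lam, of u] u(1) c_nonzero by simp
  ultimately show ?thesis
    by (intro exI[of _ "fls_shift (- R) (fps_to_fls u)"]) simp
qed

end

theorem theorem1:
  fixes n :: nat and a :: "nat \<Rightarrow> complex poly" and p q :: "nat \<Rightarrow> nat"
    and x0 c :: complex and r :: int and s :: nat and lam :: rat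
  assumes "equation_data n a p q"
    and "nonsingular_point n a x0"
    and "s > 0" and "coprime r (int s)" and "lam = of_int r / of_nat s" and "lam \<noteq> 0"
    and "has_inclined_edge n p q (of_rat lam)"
    and "non_exceptional_solution n a p q x0 lam c"
  shows "\<exists>\<phi>. has_first_term \<phi> c lam \<and> ode_lhs n a p q x0 \<phi> = 0 \<and>
           (\<forall>\<psi>. has_first_term \<psi> c lam \<and> ode_lhs n a p q x0 \<psi> = 0 \<longrightarrow> \<psi> = \<phi>) \<and>
           puiseux_convergent \<phi> \<and> exponents_generated_by (1 / of_nat s) \<phi>"
proof -
  have edge_eq: "puiseux_edge_equation n a p q x0 c lam (s * k) (r * int k)" if "k > 0" for k
    using assms that
    by unfold_locales (auto simp: non_exceptional_solution_def)
  \<comment> \<open>Solving with \<open>K = s\<close> places all exponents among the multiples of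
    \<open>1 / s\<close>.\<close>
  obtain L where L: "has_first_term (puiseux_of_fls s L) c lam"
      "ode_lhs n a p q x0 (puiseux_of_fls s L) = 0" "fls_conv_radius L > 0"
    using puiseux_edge_equation.puiseux_solution_exists[OF edge_eq[of 1]] by auto
  define \<phi> where "\<phi> = puiseux_of_fls s L"
  have unique: "\<psi> = \<phi>" if \<psi>: "has_first_term \<psi> c lam" "ode_lhs n a p q x0 \<psi> = 0" for \<psi>
  proof -
    \<comment> \<open>\<open>\<psi>\<close> may need a denominator unrelated to \<open>s\<close>.
      Both series are rewritten with the denominator \<open>s * (k1 * k2)\<close>, where uniqueness
      of Laurent solutions applies.\<close>
    obtain k1 where k1: "k1 > 0" "\<And>d. d > 0 \<Longrightarrow> \<exists>L. \<phi> = puiseux_of_fls (k1 * d) L"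
      using ex_puiseux_of_fls[of \<phi>] by blast
    obtain k2 where k2: "k2 > 0" "\<And>d. d > 0 \<Longrightarrow> \<exists>L. \<psi> = puiseux_of_fls (k2 * d) L"
      using ex_puiseux_of_fls[of \<psi>] by blast
    obtain L1 where L1: "\<phi> = puiseux_of_fls (s * (k1 * k2)) L1"
      using k1(2)[of "s * k2"] k2(1) assms(3) by (auto simp: mult_ac)
    obtain L2 where L2: "\<psi> = puiseux_of_fls (s * (k1 * k2)) L2"
      using k2(2)[of "s * k1"] k1(1) assms(3) by (auto simp: mult_ac)
    interpret puiseux_edge_equation n a p q x0 c lam "s * (k1 * k2)" "r * int (k1 * k2)"
      using k1(1) k2(1) by (intro edge_eq) simp
    have "L2 = L1"
      using \<psi> L(1,2) puiseux_solution_unique[of L2 L1] unfolding \<phi>_def[symmetric] L1 L2 by blast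
    then show ?thesis by (simp add: L1 L2)
  qed
  have "exponents_generated_by (1 / of_nat s) \<phi>"
    unfolding exponents_generated_by_def
  proof (intro allI impI)
    fix e assume "puiseux_coeff \<phi> e \<noteq> 0"
    then have "of_nat s * e \<in> \<int>"
      using assms(3) by (auto simp: \<phi>_def puiseux_coeff_of_fls split: if_splits)
    then obtain j where "of_nat s * e = of_int j" by (auto elim: Ints_cases)
    then show "\<exists>j::int. e = of_int j * (1 / of_nat s)"
      using assms(3) by (intro exI[of _ j]) (simp add: field_simps)
  qed
  moreover have "puiseux_convergent \<phi>"
    using assms(3) L(3) by (auto simp: puiseux_convergent_def \<phi>_def)
  ultimately show ?thesis using L(1,2) unique unfolding \<phi>_def[symmetric] by blast
qed

end
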